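(* Let $R=R(X_\ell,S)$ be a simply laced extended affine root system of type $X_\ell$ and nullity $\nu$, with extended affine Weyl group $\mathcal W$, and let $\dot{\mathcal W}\le\mathcal W$ be the finite Weyl group of $\dot R$. (i) If $X_\ell=A_1$, then each $w\in\mathcal W$ has a unique expression in the form $$w=w_{\alpha_1}^n\prod_{r=1}^{\nu}t_{1,r}^{m_r}\,z\qquad(n\in\{0,1\},\ m_r\in\mathbb Z,\ z\in F(S)).$$ (ii) If $X_\ell=A_\ell$ ($\ell\ge2$), $D_\ell$ or $E_\ell$, then each $w\in\mathcal W$ has a unique expression in the form $$w=\dot w\prod_{r=1}^{\nu}\prod_{i=1}^{\ell}t_{i,r}^{m_{i,r}}\prod_{1\le r<s\le\nu}c_{r,s}^{m_{r,s}},\qquad \dot w\in\dot{\mathcal W},\ m_{i,r},m_{r,s}\in\mathbb Z.$$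
   Context: Products over integer indices are taken in increasing order of the index (from left to right). Extended affine root systems. Let $V$ be a nontrivial finite-dimensional real vector space with a positive semidefinite symmetric bilinear form $(\cdot,\cdot)$ with radical $V^0$; for nonisotropic $\alpha$ put $\alpha^\vee=2\alpha/(\alpha,\alpha)$, and for $A\subseteq V$ let $A^\times=\{\alpha\in A:(\alpha,\alpha)\neq0\}$. A subset $R\subseteq V$ is an extended affine root system if: $0\in R$; $-R=R$; $R$ spans $V$; $\alpha\in R^\times\Rightarrow 2\alpha\notin R$; $R$ is discrete; for $\alpha\in R^\times,\beta\in R$ there are integers $d,u\ge0$ such that, for $n\in\mathbb Z$, $\beta+n\alpha\in R\iff -d\le n\le u$, and $(\beta,\alpha^\vee)=d-u$; $R$ is not a union of two nonempty mutually orthogonal subsets; for each isotropic $\sigma\in R$ there is $\alpha\in R^\times$ with $\alpha+\sigma\in R$. Nullity: $\nu=\dim V^0$; rank: $\ell=\dim V/V^0$; the type is that of the image of $R$ in $V/V^0$, an irreducible finite root system (with $0$ included). $R$ is simply laced if its type $X_\ell$ is $A_\ell$, $D_\ell$, $E_6$, $E_7$ or $E_8$. A semilattice in $V^0$ is a discrete spanning subset $S$ with $0\in S$ and $S\pm2S\subseteq S$; it is a lattice if $S\pm S\subseteq S$. By known structure theory, for $R$ simply laced one can fix a complement $\dot V$ of $V^0$ in $V$ such that $\dot R=\{\dot\alpha\in\dot V:\dot\alpha+\sigma\in R\text{ for some }\sigma\in V^0\}$ is a finite root system of type $X_\ell$ (with $0$) in $\dot V$ and $R=R(X_\ell,S)=(S+S)\cup(\dot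 R+S)$ with $S$ a semilattice in $V^0$; if $\ell>1$, $S$ is a lattice. Fix a fundamental system $\alpha_1,\dots,\alpha_\ell$ of $\dot R$, with $(\alpha_i,\alpha_i)=2$, and a $\mathbb Z$-basis $B=\{\sigma_1,\dots,\sigma_\nu\}\subseteq S$ of the lattice $\Lambda$ generated by $S$. Supporting class: for $\sigma\in\Lambda$ let $\mathrm{supp}(\sigma)\subseteq\{1,\dots,\nu\}$ be the set of $r$ for which the coefficient of $\sigma_r$ in $\sigma$ is odd, and $\mathrm{supp}(S)=\{\mathrm{supp}(\sigma):\sigma\in S\}$; then $S=\biguplus_{J\in\mathrm{supp}(S)}(\sum_{r\in J}\sigma_r+2\Lambda)$. Groups: $\tilde V=V\oplus(V^0)^*$, with the form extended from $V$ by $(\dot V,(V^0)^* )=((V^0)^*,(V^0)^* )=0$ and $(\sigma_r,\lambda_s)=\delta_{r,s}$, where $\lambda_1,\dots,\lambda_\nu$ is a basis of $(V^0)^*$. For $\alpha\in V^\times$, $w_\alpha(u)=u-(u,\alpha^\vee)\alpha$ ($u\in\tilde V$). $\mathcal W=\langle w_\alpha:\alpha\in R^\times\rangle\le GL(\tilde V)$ and $\dot{\mathcal W}=\langle w_\alpha:\alpha\in\dot R^\times\rangle\le\mathcal W$. For $\alpha\in V,\sigma\in V^0$ put $T_\alpha^\sigma(u)=u-(\sigma,u)\alpha+(\alpha,u)\sigma-\frac{(\alpha,\alpha)}2(\sigma,u)\sigma$; $t_{i,r}=T_{\alpha_i}^{\sigma_r}$ and $c_{r,s}=T_{\sigma_r}^{\sigma_s}$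 (the $c_{r,s}$ commute). For $J\subseteq\{1,\dots,\nu\}$ put $z_J=\prod_{r,s\in J,\,r<s}c_{r,s}$ if $J\in\mathrm{supp}(S)$ (empty product $=1$); $z_J=c_{r,s}^2$ if $J=\{r,s\}\notin\mathrm{supp}(S)$, $r<s$; $z_J=1$ otherwise. $F(S)=\langle z_J:J\subseteq\{1,\dots,\nu\}\rangle$. *)

theory Defs
  imports
    "HOL-Analysis.Analysis"
    "HOL-Algebra.Bij"
    "HOL-Algebra.Generated_Groups"
begin

section \<open>Forms, radical, roots\<close>

text \<open>
  The space \<open>V\<close> is the whole type \<open>'v\<close> of class \<^class>\<open>euclidean_space\<close>, hence nontrivial and of
  finite dimension.  The inner product of the class is used only for its topology (the unique
  Hausdorff vector space topology of \<open>V\<close>); the form of the root system is a separate parameter.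
\<close>

definition psd_form :: "('v::euclidean_space \<Rightarrow> 'v \<Rightarrow> real) \<Rightarrow> bool" where
  "psd_form form \<longleftrightarrow>
     bilinear form \<and> (\<forall>u v. form u v = form v u) \<and> (\<forall>v. 0 \<le> form v v)"

definition form_radical :: "('v::euclidean_space \<Rightarrow> 'v \<Rightarrow> real) \<Rightarrow> 'v set" where
  "form_radical form = {v. \<forall>u. form v u = 0}"

definition nullity :: "('v::euclidean_space \<Rightarrow> 'v \<Rightarrow> real) \<Rightarrow> nat" where
  "nullity form = dim (form_radical form)"

text \<open>\<open>dim (V / V\<^sup>0)\<close>, written without the quotient space.\<close>

definition form_rank :: "('v::euclidean_space \<Rightarrow> 'v \<Rightarrow> real) \<Rightarrow> nat" where
  "form_rank form = DIM('v) - dim (form_radical form)"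

definition coroot :: "('v::euclidean_space \<Rightarrow> 'v \<Rightarrow> real) \<Rightarrow> 'v \<Rightarrow> 'v" where
  "coroot form \<alpha> = (2 / form \<alpha> \<alpha>) *\<^sub>R \<alpha>"

definition nonisotropic :: "('v::euclidean_space \<Rightarrow> 'v \<Rightarrow> real) \<Rightarrow> 'v set \<Rightarrow> 'v set" where
  "nonisotropic form A = {\<alpha> \<in> A. form \<alpha> \<alpha> \<noteq> 0}"

text \<open>
  Indecomposability is required of the set of nonisotropic roots: \<open>0\<close> and all isotropic roots are
  orthogonal to everything, so no set containing \<open>0\<close> and another vector could be indecomposable
  itself.
\<close>

definition extended_affine_root_system ::
  "('v::euclidean_space \<Rightarrow> 'v \<Rightarrow> real) \<Rightarrow> 'v set \<Rightarrow> bool" where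
  "extended_affine_root_system form R \<longleftrightarrow>
     psd_form form \<and>
     0 \<in> R \<and>
     uminus ` R = R \<and>
     span R = UNIV \<and>
     (\<forall>\<alpha> \<in> nonisotropic form R. 2 *\<^sub>R \<alpha> \<notin> R) \<and>
     discrete R \<and>
     (\<forall>\<alpha> \<in> nonisotropic form R. \<forall>\<beta> \<in> R. \<exists>d u :: nat.
        (\<forall>n :: int. \<beta> + of_int n *\<^sub>R \<alpha> \<in> R \<longleftrightarrow> - int d \<le> n \<and> n \<le> int u) \<and>
        form \<beta> (coroot form \<alpha>) = real d - real u) \<and>
     \<not> (\<exists>P Q. P \<noteq> {} \<and> Q \<noteq> {} \<and> P \<union> Q = nonisotropic form R \<and>
              (\<forall>\<alpha> \<in> P. \<forall>\<beta> \<in> Q. form \<alpha> \<beta> = 0)) \<and>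
     (\<forall>\<sigma> \<in> R. form \<sigma> \<sigma> = 0 \<longrightarrow> (\<exists>\<alpha> \<in> nonisotropic form R. \<alpha> + \<sigma> \<in> R))"


section \<open>Finite root systems of simply laced type\<close>

text \<open>Reduced finite root systems in a subspace \<open>U\<close>, with \<open>0\<close> included.\<close>

definition finite_root_system ::
  "('v::euclidean_space \<Rightarrow> 'v \<Rightarrow> real) \<Rightarrow> 'v set \<Rightarrow> 'v set \<Rightarrow> bool" where
  "finite_root_system form U \<Phi> \<longleftrightarrow>
     finite \<Phi> \<and> 0 \<in> \<Phi> \<and> span \<Phi> = U \<and>
     (\<forall>\<alpha> \<in> \<Phi> - {0}. 0 < form \<alpha> \<alpha> \<and> 2 *\<^sub>R \<alpha> \<notin> \<Phi> \<and>
        (\<forall>\<beta> \<in> \<Phi>. form \<beta> (coroot form \<alpha>) \<in> \<int> \<and> \<beta> - form \<beta> (coroot form \<alpha>) *\<^sub>R \<alpha> \<in> \<Phi>))"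

definition fundamental_system :: "'v::euclidean_space set \<Rightarrow> nat \<Rightarrow> (nat \<Rightarrow> 'v) \<Rightarrow> bool" where
  "fundamental_system \<Phi> l \<alpha> \<longleftrightarrow>
     \<alpha> ` {1..l} \<subseteq> \<Phi> \<and> inj_on \<alpha> {1..l} \<and> independent (\<alpha> ` {1..l}) \<and>
     (\<forall>\<beta> \<in> \<Phi>. \<exists>n :: nat \<Rightarrow> nat. \<beta> = (\<Sum>i = 1..l. real (n i) *\<^sub>R \<alpha> i) \<or>
                                \<beta> = - (\<Sum>i = 1..l. real (n i) *\<^sub>R \<alpha> i))"

datatype simply_laced_type = TypeA nat | TypeD nat | TypeE nat

fun type_rank :: "simply_laced_type \<Rightarrow> nat" where
  "type_rank (TypeA l) = l"
| "type_rank (TypeD l) = l"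
| "type_rank (TypeE l) = l"

fun valid_type :: "simply_laced_type \<Rightarrow> bool" where
  "valid_type (TypeA l) \<longleftrightarrow> 1 \<le> l"
| "valid_type (TypeD l) \<longleftrightarrow> 4 \<le> l"
| "valid_type (TypeE l) \<longleftrightarrow> l \<in> {6, 7, 8}"

text \<open>Edges of the Dynkin diagrams, with the vertices \<open>1, \<dots>, l\<close> numbered as in Bourbaki.\<close>

fun dynkin_edges :: "simply_laced_type \<Rightarrow> nat set set" where
  "dynkin_edges (TypeA l) = {{i, i + 1} | i. 1 \<le> i \<and> i < l}"
| "dynkin_edges (TypeD l) = {{i, i + 1} | i. 1 \<le> i \<and> i < l - 1} \<union> {{l - 2, l}}"
| "dynkin_edges (TypeE l) = {{1, 3}, {2, 4}} \<union> {{i, i + 1} | i. 3 \<le> i \<and> i < l}"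

definition cartan_integer :: "simply_laced_type \<Rightarrow> nat \<Rightarrow> nat \<Rightarrow> int" where
  "cartan_integer X i j =
     (if i = j then 2 else if {i, j} \<in> dynkin_edges X then - 1 else 0)"

definition finite_root_system_of_type ::
  "('v::euclidean_space \<Rightarrow> 'v \<Rightarrow> real) \<Rightarrow> 'v set \<Rightarrow> 'v set \<Rightarrow> simply_laced_type \<Rightarrow> bool" where
  "finite_root_system_of_type form U \<Phi> X \<longleftrightarrow>
     finite_root_system form U \<Phi> \<and> valid_type X \<and>
     (\<exists>\<beta>. fundamental_system \<Phi> (type_rank X) \<beta> \<and>
          (\<forall>i \<in> {1..type_rank X}. \<forall>j \<in> {1..type_rank X}.
             form (\<beta> i) (coroot form (\<beta> j)) = of_int (cartan_integer X i j)))"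

text \<open>
  The set of representatives in a complement \<open>Vd\<close> of \<open>V\<^sup>0\<close> of the image of \<open>R\<close> in \<open>V / V\<^sup>0\<close>.
  As \<open>Vd\<close> is isometric to \<open>V / V\<^sup>0\<close>, the type of \<open>R\<close> is the type of this set.
\<close>

definition finite_part ::
  "('v::euclidean_space \<Rightarrow> 'v \<Rightarrow> real) \<Rightarrow> 'v set \<Rightarrow> 'v set \<Rightarrow> 'v set" where
  "finite_part form Vd R = {a \<in> Vd. \<exists>\<sigma> \<in> form_radical form. a + \<sigma> \<in> R}"


section \<open>Semilattices and supporting classes\<close>

definition semilattice_in :: "'v::euclidean_space set \<Rightarrow> 'v set \<Rightarrow> bool" where
  "semilattice_in U S \<longleftrightarrow>
     discrete S \<and> span S = U \<and> 0 \<in> S \<and>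
     (\<forall>\<sigma> \<in> S. \<forall>\<tau> \<in> S. \<sigma> + 2 *\<^sub>R \<tau> \<in> S \<and> \<sigma> - 2 *\<^sub>R \<tau> \<in> S)"

definition lattice_in :: "'v::euclidean_space set \<Rightarrow> 'v set \<Rightarrow> bool" where
  "lattice_in U S \<longleftrightarrow>
     semilattice_in U S \<and> (\<forall>\<sigma> \<in> S. \<forall>\<tau> \<in> S. \<sigma> + \<tau> \<in> S \<and> \<sigma> - \<tau> \<in> S)"

text \<open>\<open>V\<close> as a \<open>\<int>\<close>-module: \<open>zmod.span S\<close> is the additive subgroup generated by \<open>S\<close>.\<close>

interpretation zmod: module "\<lambda>(k::int) (x::'v::euclidean_space). of_int k *\<^sub>R x"
  by standard (auto simp: algebra_simps)

definition int_basis_of :: "(nat \<Rightarrow> 'v::euclidean_space) \<Rightarrow> nat \<Rightarrow> 'v set \<Rightarrow> bool" where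
  "int_basis_of \<sigma> nu L \<longleftrightarrow>
     inj_on \<sigma> {1..nu} \<and> zmod.independent (\<sigma> ` {1..nu}) \<and> zmod.span (\<sigma> ` {1..nu}) = L"

definition supp :: "(nat \<Rightarrow> 'v::euclidean_space) \<Rightarrow> nat \<Rightarrow> 'v \<Rightarrow> nat set" where
  "supp \<sigma> nu x = {r \<in> {1..nu}. odd (zmod.representation (\<sigma> ` {1..nu}) x (\<sigma> r))}"

definition supp_class :: "(nat \<Rightarrow> 'v::euclidean_space) \<Rightarrow> nat \<Rightarrow> 'v set \<Rightarrow> nat set set" where
  "supp_class \<sigma> nu S = supp \<sigma> nu ` S"


section \<open>The hyperbolic extension and the Weyl groups\<close>

text \<open>
  Given a complement \<open>Vd\<close> of \<open>V\<^sup>0\<close>, the dual space of \<open>V\<^sup>0\<close> is identified, by restriction to \<open>V\<^sup>0\<close>,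
  with the space of linear functionals on \<open>V\<close> that vanish on \<open>Vd\<close> (on a finite-dimensional \<open>V\<close>
  every functional is bounded).  With this identification, \<open>V \<oplus> (V\<^sup>0)\<^sup>*\<close> is the following subspace
  of \<open>V \<times> V\<^sup>*\<close>, and the extended form pairs a vector with a functional by evaluation.  That
  \<open>Vd\<close> is orthogonal to \<open>(V\<^sup>0)\<^sup>*\<close> is thereby built in, and a basis \<open>\<lambda>\<^sub>1, \<dots>, \<lambda>\<^sub>\<nu>\<close> of \<open>(V\<^sup>0)\<^sup>*\<close>
  with \<open>(\<sigma>\<^sub>r, \<lambda>\<^sub>s) = \<delta>\<^sub>r\<^sub>s\<close> is the dual basis of \<open>\<sigma>\<^sub>1, \<dots>, \<sigma>\<^sub>\<nu>\<close>.
\<close>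

definition ext_space :: "'v::euclidean_space set \<Rightarrow> ('v \<times> ('v \<Rightarrow>\<^sub>L real)) set" where
  "ext_space Vd = UNIV \<times> {f. \<forall>x \<in> Vd. blinfun_apply f x = 0}"

definition ext_form ::
  "('v::euclidean_space \<Rightarrow> 'v \<Rightarrow> real) \<Rightarrow> 'v \<times> ('v \<Rightarrow>\<^sub>L real) \<Rightarrow> 'v \<times> ('v \<Rightarrow>\<^sub>L real) \<Rightarrow> real" where
  "ext_form form u v =
     form (fst u) (fst v) + blinfun_apply (snd u) (fst v) + blinfun_apply (snd v) (fst u)"

text \<open>
  The general linear group of a subspace \<open>U\<close>; its elements are extensional functions, undefined
  off \<open>U\<close>.
\<close>

definition GL :: "'w::real_vector set \<Rightarrow> ('w \<Rightarrow> 'w) monoid" where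
  "GL U = (BijGroup U)
     \<lparr>carrier := {f \<in> Bij U. \<forall>x \<in> U. \<forall>y \<in> U. \<forall>a b.
                     f (a *\<^sub>R x + b *\<^sub>R y) = a *\<^sub>R f x + b *\<^sub>R f y}\<rparr>"

definition refl_op ::
  "('v::euclidean_space \<Rightarrow> 'v \<Rightarrow> real) \<Rightarrow> 'v set \<Rightarrow> 'v \<Rightarrow>
     'v \<times> ('v \<Rightarrow>\<^sub>L real) \<Rightarrow> 'v \<times> ('v \<Rightarrow>\<^sub>L real)" where
  "refl_op form Vd \<alpha> =
     (\<lambda>u \<in> ext_space Vd. u - ext_form form u (coroot form \<alpha>, 0) *\<^sub>R (\<alpha>, 0))"

text \<open>\<open>T_op form Vd \<alpha> \<sigma>\<close> is the map with subscript \<open>\<alpha> \<in> V\<close> and superscript \<open>\<sigma> \<in> V\<^sup>0\<close>.\<close>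

definition T_op ::
  "('v::euclidean_space \<Rightarrow> 'v \<Rightarrow> real) \<Rightarrow> 'v set \<Rightarrow> 'v \<Rightarrow> 'v \<Rightarrow>
     'v \<times> ('v \<Rightarrow>\<^sub>L real) \<Rightarrow> 'v \<times> ('v \<Rightarrow>\<^sub>L real)" where
  "T_op form Vd \<alpha> \<sigma> =
     (\<lambda>u \<in> ext_space Vd.
        u - ext_form form (\<sigma>, 0) u *\<^sub>R (\<alpha>, 0) + ext_form form (\<alpha>, 0) u *\<^sub>R (\<sigma>, 0)
          - (form \<alpha> \<alpha> / 2 * ext_form form (\<sigma>, 0) u) *\<^sub>R (\<sigma>, 0))"

definition weyl_group ::
  "('v::euclidean_space \<Rightarrow> 'v \<Rightarrow> real) \<Rightarrow> 'v set \<Rightarrow> 'v set \<Rightarrow>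
     ('v \<times> ('v \<Rightarrow>\<^sub>L real) \<Rightarrow> 'v \<times> ('v \<Rightarrow>\<^sub>L real)) set" where
  "weyl_group form Vd R =
     generate (GL (ext_space Vd)) (refl_op form Vd ` nonisotropic form R)"

text \<open>Product of a family over a list of indices, from left to right.\<close>

definition ordered_prod :: "('g, 'b) monoid_scheme \<Rightarrow> ('i \<Rightarrow> 'g) \<Rightarrow> 'i list \<Rightarrow> 'g" where
  "ordered_prod G f xs = foldr (\<lambda>i p. f i \<otimes>\<^bsub>G\<^esub> p) xs \<one>\<^bsub>G\<^esub>"

definition index_pairs :: "nat \<Rightarrow> (nat \<times> nat) list" where
  "index_pairs nu = [(r, s). r \<leftarrow> [1..<nu + 1], s \<leftarrow> [r + 1..<nu + 1]]"

definition c_op ::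
  "('v::euclidean_space \<Rightarrow> 'v \<Rightarrow> real) \<Rightarrow> 'v set \<Rightarrow> (nat \<Rightarrow> 'v) \<Rightarrow> nat \<Rightarrow> nat \<Rightarrow>
     'v \<times> ('v \<Rightarrow>\<^sub>L real) \<Rightarrow> 'v \<times> ('v \<Rightarrow>\<^sub>L real)" where
  "c_op form Vd \<sigma> r s = T_op form Vd (\<sigma> r) (\<sigma> s)"

definition z_op ::
  "('v::euclidean_space \<Rightarrow> 'v \<Rightarrow> real) \<Rightarrow> 'v set \<Rightarrow> 'v set \<Rightarrow> (nat \<Rightarrow> 'v) \<Rightarrow> nat \<Rightarrow> nat set \<Rightarrow>
     'v \<times> ('v \<Rightarrow>\<^sub>L real) \<Rightarrow> 'v \<times> ('v \<Rightarrow>\<^sub>L real)" where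
  "z_op form Vd S \<sigma> nu J =
     (if J \<in> supp_class \<sigma> nu S then
        ordered_prod (GL (ext_space Vd)) (\<lambda>(r, s). c_op form Vd \<sigma> r s)
          (filter (\<lambda>(r, s). r \<in> J \<and> s \<in> J) (index_pairs nu))
      else if card J = 2 then
        c_op form Vd \<sigma> (Min J) (Max J) [^]\<^bsub>GL (ext_space Vd)\<^esub> (2::nat)
      else \<one>\<^bsub>GL (ext_space Vd)\<^esub>)"

definition F_group ::
  "('v::euclidean_space \<Rightarrow> 'v \<Rightarrow> real) \<Rightarrow> 'v set \<Rightarrow> 'v set \<Rightarrow> (nat \<Rightarrow> 'v) \<Rightarrow> nat \<Rightarrow>
     ('v \<times> ('v \<Rightarrow>\<^sub>L real) \<Rightarrow> 'v \<times> ('v \<Rightarrow>\<^sub>L real)) set" where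
  "F_group form Vd S \<sigma> nu = generate (GL (ext_space Vd)) (z_op form Vd S \<sigma> nu ` Pow {1..nu})"

end

theory Submission
  imports Defs
begin

text \<open>
  Both normal forms come from an explicit parametrization of the unipotent operators by vectors
  \<open>p\<^sub>1, \<dots>, p\<^sub>\<nu>\<close> of \<open>Vd\<close> and numbers \<open>k\<^sub>r\<^sub>s\<close>, for \<open>r < s\<close>: the operator \<open>heis p k\<close> is the product of the
  \<open>T\<close> with subscript \<open>p\<^sub>r\<close> and superscript \<open>\<sigma>\<^sub>r\<close>, in increasing order of \<open>r\<close>, times the product of the
  powers of \<open>c\<^sub>r\<^sub>s\<close> with exponents \<open>k\<^sub>r\<^sub>s\<close>.  When two such operators are multiplied, the parameters add up,
  except that \<open>(p\<^sub>s, q\<^sub>r)\<close> is subtracted from the entry of \<open>k\<close> at \<open>r < s\<close> (\<open>heis_mult\<close>).  The products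
  in the theorem are therefore operators \<open>heis p k\<close> with \<open>p\<^sub>r = \<Sum>\<^sub>i m\<^sub>i\<^sub>r \<alpha>\<^sub>i\<close>, and the claim is that each
  element of the Weyl group has a unique factorization \<open>wd \<otimes> heis p k\<close> with suitable parameters.
  
  Uniqueness holds because elements of the finite Weyl group act on \<open>V\<close> alone and fix \<open>V\<^sup>0\<close>, while
  unipotent operators act trivially on \<open>V / V\<^sup>0\<close>; the parameters can be read off from the values at the
  dual basis of \<open>\<sigma>\<close> (\<open>weyl_heis_unique\<close>, \<open>heis_eqD\<close>).
  
  For existence, the set of products \<open>wd \<otimes> heis p k\<close> is shown to be stable under right multiplication by
  the generating reflections (\<open>weyl_factorization\<close>).  If \<open>\<tau> = \<Sum>\<^sub>r a\<^sub>r \<sigma>\<^sub>r\<close>, then the reflection in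
  \<open>\<beta> + \<tau>\<close> is \<open>w\<^sub>\<beta>\<close> times the unipotent operator with parameters \<open>- a\<^sub>r \<beta>\<close> and \<open>- a\<^sub>r a\<^sub>s\<close>
  (\<open>refl_op_translate\<close>), and moving \<open>w\<^sub>\<beta>\<close> past \<open>heis p k\<close> reflects \<open>p\<close> (\<open>heis_refl_op\<close>).  So \<open>p\<close>
  stays in the root lattice, and \<open>k\<close> changes by the products \<open>a\<^sub>r a\<^sub>s\<close> and by integers \<open>a\<^sub>r (p\<^sub>s, \<beta>)\<close>.
  In higher rank one only has to know that these are integers.  In rank one the latter are even, because
  the roots have square length \<open>2\<close>, and modulo \<open>2\<close> the former are the exponents of the generator
  \<open>z\<^sub>J\<close> with \<open>J\<close> the support of \<open>\<tau>\<close>; since \<open>F(S)\<close> contains all \<open>c\<^sub>r\<^sub>s\<close> squared, the central factor stays in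
  \<open>F(S)\<close> (\<open>quadratic_central_in_F\<close>).
  
  That all roots of the finite root system have the length of the simple ones is
  \<open>simply_laced_root_norm\<close>.
\<close>

(* Keeps the index ranges {1..n} from being rewritten to {Suc 0..n}. *)
declare One_nat_def [simp del]

section \<open>Linear groups and ordered products\<close>

lemma subgroup_GL:
  fixes U :: "'w::real_vector set"
  assumes "subspace U"
  shows "subgroup (carrier (GL U)) (BijGroup U)"
proof -
  interpret B: group "BijGroup U" by (rule group_BijGroup)
  let ?L = "carrier (GL U)"
  have lin: "f (a *\<^sub>R x + b *\<^sub>R y) = a *\<^sub>R f x + b *\<^sub>R f y"
    if "f \<in> ?L" "x \<in> U" "y \<in> U" for f a b x y
    using that by (simp add: GL_def)
  have bij: "f \<in> Bij U" if "f \<in> ?L" for f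
    using that by (simp add: GL_def)
  have comb: "a *\<^sub>R x + b *\<^sub>R y \<in> U" if "x \<in> U" "y \<in> U" for a b x y
    using assms that by (simp add: subspace_add subspace_scale)
  show ?thesis
  proof (rule B.subgroupI)
    show "?L \<subseteq> carrier (BijGroup U)"
      by (auto simp: GL_def BijGroup_def)
    have "(\<lambda>x\<in>U. x) \<in> ?L"
      using comb by (simp add: GL_def id_Bij)
    then show "?L \<noteq> {}"
      by blast
  next
    fix f assume f: "f \<in> ?L"
    have inv: "inv\<^bsub>BijGroup U\<^esub> f = restrict (inv_into U f) U"
      using bij[OF f] by (rule inv_BijGroup)
    have bb: "bij_betw f U U"
      using bij[OF f] by (simp add: Bij_def)
    have "inv_into U f (a *\<^sub>R x + b *\<^sub>R y) = a *\<^sub>R inv_into U f x + b *\<^sub>R inv_into U f y"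
      if "x \<in> U" "y \<in> U" for a b x y
    proof (rule inv_into_f_eq)
      show "inj_on f U" using bb by (simp add: bij_betw_def)
      have mem: "inv_into U f x \<in> U" "inv_into U f y \<in> U"
        using bij[OF f] that by (simp_all add: Bij_inv_into_mem)
      then show "a *\<^sub>R inv_into U f x + b *\<^sub>R inv_into U f y \<in> U"
        by (rule comb)
      show "f (a *\<^sub>R inv_into U f x + b *\<^sub>R inv_into U f y) = a *\<^sub>R x + b *\<^sub>R y"
        using lin[OF f mem] bb that by (simp add: bij_betw_inv_into_right)
    qed
    then show "inv\<^bsub>BijGroup U\<^esub> f \<in> ?L"
      unfolding inv using restrict_inv_into_Bij[OF bij[OF f]] comb by (simp add: GL_def)
  next
    fix f g assume f: "f \<in> ?L" and g: "g \<in> ?L"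
    have "g x \<in> U" if "x \<in> U" for x
      using Bij_imp_funcset[OF bij[OF g]] that by auto
    then show "f \<otimes>\<^bsub>BijGroup U\<^esub> g \<in> ?L"
      using bij[OF f] bij[OF g] lin[OF f] lin[OF g] comb
      by (simp add: BijGroup_def GL_def compose_Bij) (simp add: compose_def)
  qed
qed

lemma group_GL: "subspace U \<Longrightarrow> group (GL U)"
  using group.subgroup_imp_group[OF group_BijGroup subgroup_GL, of U] by (simp add: GL_def)

lemma GL_mult: "f \<in> carrier (GL U) \<Longrightarrow> g \<in> carrier (GL U) \<Longrightarrow> f \<otimes>\<^bsub>GL U\<^esub> g = compose U f g"
  by (simp add: GL_def BijGroup_def)

lemma GL_one: "\<one>\<^bsub>GL U\<^esub> = (\<lambda>x\<in>U. x)"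
  by (simp add: GL_def BijGroup_def)

lemma GL_memI:
  assumes "f \<in> extensional U" "\<And>x. x \<in> U \<Longrightarrow> f x \<in> U"
    and "\<And>x. x \<in> U \<Longrightarrow> g x \<in> U" "\<And>x. x \<in> U \<Longrightarrow> f (g x) = x" "\<And>x. x \<in> U \<Longrightarrow> g (f x) = x"
    and "\<And>x y a b. x \<in> U \<Longrightarrow> y \<in> U \<Longrightarrow> f (a *\<^sub>R x + b *\<^sub>R y) = a *\<^sub>R f x + b *\<^sub>R f y"
  shows "f \<in> carrier (GL U)"
proof -
  have "bij_betw f U U"
    by (rule bij_betw_byWitness[where f' = g]) (use assms in auto)
  then show ?thesis
    using assms by (simp add: GL_def Bij_def)
qed

lemma GL_eqI:
  "f \<in> carrier (GL U) \<Longrightarrow> g \<in> carrier (GL U) \<Longrightarrow> (\<And>x. x \<in> U \<Longrightarrow> f x = g x) \<Longrightarrow> f = g"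
  by (rule extensionalityI[where A = U]) (auto simp: GL_def Bij_def)

lemma ordered_prod_Nil [simp]: "ordered_prod G f [] = \<one>\<^bsub>G\<^esub>"
  and ordered_prod_Cons [simp]: "ordered_prod G f (x # xs) = f x \<otimes>\<^bsub>G\<^esub> ordered_prod G f xs"
  by (simp_all add: ordered_prod_def)

lemma ordered_prod_cong: "(\<And>x. x \<in> set xs \<Longrightarrow> f x = g x) \<Longrightarrow> ordered_prod G f xs = ordered_prod G g xs"
  by (induction xs) auto

lemma (in subgroup) ordered_prod_mem:
  "(\<And>x. x \<in> set xs \<Longrightarrow> f x \<in> H) \<Longrightarrow> ordered_prod G f xs \<in> H"
  by (induction xs) auto

lemma (in monoid) pow_one: "x \<in> carrier G \<Longrightarrow> x [^] (1 :: nat) = x"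
  by (simp add: One_nat_def)

text \<open>
  Every family of operators indexed by a scalar below is additive in the scalar, so this turns an
  integer power of the member with scalar \<open>1\<close> into another member of the family.
\<close>

lemma (in group) int_pow_of_additive:
  fixes f :: "int \<Rightarrow> 'a"
  assumes carr: "\<And>a. f a \<in> carrier G" and add: "\<And>a b. f (a + b) = f a \<otimes> f b"
  shows "f 1 [^] m = f m"
proof -
  have zero: "f 0 = \<one>"
    using add[of 0 0] carr[of 0] by (metis add_0 l_cancel_one')
  have nat: "f 1 [^] (n::nat) = f (int n)" for n
  proof (induction n)
    case (Suc n)
    have "f (int (Suc n)) = f (int n) \<otimes> f 1"
      using add[of "int n" 1] by (simp add: add.commute)
    with Suc show ?case
      by simp
  qed (simp add: zero)
  show ?thesis
  proof (cases m rule: int_cases2)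
    case (nonneg n)
    then show ?thesis
      by (simp add: int_pow_int nat)
  next
    case (nonpos n)
    have "f (- int n) \<otimes> f (int n) = \<one>"
      using add[of "- int n" "int n"] by (simp add: zero)
    then have "inv (f (int n)) = f (- int n)"
      using carr by (simp add: inv_equality)
    then show ?thesis
      using nonpos carr by (simp add: int_pow_neg_int nat)
  qed
qed

text \<open>Stability only has to be tested on the generators when these are involutions.\<close>

lemma (in group) generate_right_stable:
  assumes gen: "\<And>h. h \<in> H \<Longrightarrow> h \<in> carrier G \<and> h \<otimes> h = \<one>"
    and N: "N \<subseteq> carrier G" and stable: "\<And>x h. x \<in> N \<Longrightarrow> h \<in> H \<Longrightarrow> x \<otimes> h \<in> N"
    and w: "w \<in> generate G H" and x: "x \<in> N"
  shows "x \<otimes> w \<in> N"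
proof -
  have "H \<subseteq> carrier G"
    using gen by blast
  note carr = generate_in_carrier[OF this]
  from w x show ?thesis
  proof (induction arbitrary: x)
    case one
    then show ?case using N by auto
  next
    case (incl h)
    then show ?case using stable by blast
  next
    case (inv h)
    then have "inv h = h"
      using gen by (simp add: inv_equality)
    then show ?case using inv stable by simp
  next
    case (eng h1 h2)
    then have "(x \<otimes> h1) \<otimes> h2 \<in> N"
      by blast
    then show ?case
      using eng carr N by (metis m_assoc subsetD)
  qed
qed

section \<open>The group of unipotent operators\<close>

text \<open>
  The situation of an extension \<open>V = Vd \<oplus> V\<^sup>0\<close> with a basis \<open>\<sigma>\<close> of the radical \<open>V\<^sup>0\<close>.  The basis enters
  through two facts that are used again and again: it spans \<open>V\<close> together with \<open>Vd\<close>, and it has a dual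
  basis in \<open>(V\<^sup>0)\<^sup>*\<close>.
\<close>

locale split_extension =
  fixes form :: "'v::euclidean_space \<Rightarrow> 'v \<Rightarrow> real"
    and Vd :: "'v set" and \<sigma> :: "nat \<Rightarrow> 'v" and nu :: nat
  assumes form_bilinear: "bilinear form"
    and form_sym: "form x y = form y x"
    and subspace_Vd: "subspace Vd"
    and sigma_radical: "r \<in> {1..nu} \<Longrightarrow> form (\<sigma> r) x = 0"
    and dual_functional: "s \<in> {1..nu} \<Longrightarrow> \<exists>f :: 'v \<Rightarrow>\<^sub>L real. (\<forall>x \<in> Vd. blinfun_apply f x = 0) \<and>
          (\<forall>r \<in> {1..nu}. blinfun_apply f (\<sigma> r) = (if r = s then 1 else 0))"
    and decompose: "\<exists>x \<in> Vd. \<exists>c. v = x + (\<Sum>r = 1..nu. c r *\<^sub>R \<sigma> r)"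
begin

abbreviation E where "E \<equiv> ext_space Vd"
abbreviation \<G> where "\<G> \<equiv> GL E"

lemmas form_simps =
  bilinear_ladd[OF form_bilinear] bilinear_radd[OF form_bilinear]
  bilinear_lsub[OF form_bilinear] bilinear_rsub[OF form_bilinear]
  bilinear_lmul[OF form_bilinear] bilinear_rmul[OF form_bilinear]
  bilinear_lneg[OF form_bilinear] bilinear_rneg[OF form_bilinear]
  bilinear_lzero[OF form_bilinear] bilinear_rzero[OF form_bilinear]

lemma form_sum_right: "form x (sum g A) = (\<Sum>i\<in>A. form x (g i))"
  using form_bilinear by (simp add: bilinear_def linear_sum)

lemma form_sum_left: "form (sum g A) x = (\<Sum>i\<in>A. form (g i) x)"
  using form_sum_right[of x] form_sym by simp

lemma radical_sigma: "r \<in> {1..nu} \<Longrightarrow> form x (\<sigma> r) = 0"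
  using sigma_radical form_sym by metis

lemma form_sigma_comb [simp]: "form x (\<Sum>r = 1..nu. c r *\<^sub>R \<sigma> r) = 0"
  by (simp add: form_sum_right form_simps radical_sigma)

lemma E_iff: "u \<in> E \<longleftrightarrow> (\<forall>x\<in>Vd. blinfun_apply (snd u) x = 0)"
  by (cases u) (simp add: ext_space_def)

lemma subspace_E: "subspace E"
  by (auto simp: subspace_def E_iff plus_blinfun.rep_eq scaleR_blinfun.rep_eq zero_blinfun.rep_eq)

sublocale GLE: group \<G>
  by (rule group_GL[OF subspace_E])

text \<open>
  The matrix \<open>M\<close>, up to sign, of the part of an operator that maps \<open>(V\<^sup>0)\<^sup>*\<close> to \<open>V\<^sup>0\<close>.  An operator that preserves
  the form must have \<open>M\<^sub>r\<^sub>s + M\<^sub>s\<^sub>r = (p\<^sub>r, p\<^sub>s)\<close>, so that only the entries on one side of the diagonal are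
  free; they are the numbers \<open>k\<close>.  The sign and the side are chosen so that \<open>k = 0\<close> describes the
  product of the \<open>T\<close> with superscripts \<open>\<sigma>\<^sub>1, \<dots>, \<sigma>\<^sub>\<nu>\<close> in increasing order.
\<close>

definition gram :: "(nat \<Rightarrow> 'v) \<Rightarrow> (nat \<Rightarrow> nat \<Rightarrow> real) \<Rightarrow> nat \<Rightarrow> nat \<Rightarrow> real" where
  "gram p k r s = (if r < s then form (p r) (p s) + k r s
                   else if r = s then form (p r) (p r) / 2 else - k s r)"

text \<open>
  The operator that turns out to be the product of the \<open>T\<close> with subscript \<open>p\<^sub>r\<close> and superscript \<open>\<sigma>\<^sub>r\<close>, for
  increasing \<open>r\<close>, and of the powers \<open>c\<^sub>r\<^sub>s\<close> to the \<open>k\<^sub>r\<^sub>s\<close>, for \<open>r < s\<close>.  These operators form a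
  Heisenberg-like group, whose centre contains those with \<open>p = 0\<close>.
\<close>

definition heis :: "(nat \<Rightarrow> 'v) \<Rightarrow> (nat \<Rightarrow> nat \<Rightarrow> real) \<Rightarrow> 'v \<times> ('v \<Rightarrow>\<^sub>L real) \<Rightarrow> 'v \<times> ('v \<Rightarrow>\<^sub>L real)" where
  "heis p k = (\<lambda>u\<in>E. (fst u - (\<Sum>r = 1..nu. blinfun_apply (snd u) (\<sigma> r) *\<^sub>R p r)
      + (\<Sum>r = 1..nu. (form (p r) (fst u)
            - (\<Sum>s = 1..nu. gram p k r s * blinfun_apply (snd u) (\<sigma> s))) *\<^sub>R \<sigma> r), snd u))"

lemma gram_add:
  "gram (\<lambda>r. p r + q r) (\<lambda>r s. k r s + k' r s - form (p s) (q r)) r s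
     = gram p k r s + gram q k' r s + form (p r) (q s)"
  using form_sym[of "q s" "p r"] form_sym[of "q r" "p s"]
  by (auto simp: gram_def form_simps field_simps)

lemma heis_cong:
  assumes "\<And>r. r \<in> {1..nu} \<Longrightarrow> p r = q r"
    and "\<And>r s. r \<in> {1..nu} \<Longrightarrow> s \<in> {1..nu} \<Longrightarrow> r < s \<Longrightarrow> k r s = k' r s"
  shows "heis p k = heis q k'"
proof -
  have "gram p k r s = gram q k' r s" if "r \<in> {1..nu}" "s \<in> {1..nu}" for r s
    using assms that by (auto simp: gram_def)
  then have *: "(\<Sum>s = 1..nu. gram p k r s * f s) = (\<Sum>s = 1..nu. gram q k' r s * f s)"
    if "r \<in> {1..nu}" for r f
    using that by (intro sum.cong) simp_all
  have "(\<Sum>r = 1..nu. (form (p r) v - (\<Sum>s = 1..nu. gram p k r s * f s)) *\<^sub>R \<sigma> r)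
      = (\<Sum>r = 1..nu. (form (q r) v - (\<Sum>s = 1..nu. gram q k' r s * f s)) *\<^sub>R \<sigma> r)" for v f
    using assms(1) * by (intro sum.cong) simp_all
  moreover have "(\<Sum>r = 1..nu. f r *\<^sub>R p r) = (\<Sum>r = 1..nu. f r *\<^sub>R q r)" for f
    using assms(1) by (intro sum.cong) simp_all
  ultimately show ?thesis
    by (simp add: heis_def)
qed

lemma heis_mem_E: "u \<in> E \<Longrightarrow> heis p k u \<in> E"
  by (simp add: heis_def E_iff)

lemma heis_apply_heis:
  assumes u: "u \<in> E"
  shows "heis p k (heis q k' u)
    = heis (\<lambda>r. p r + q r) (\<lambda>r s. k r s + k' r s - form (p s) (q r)) u"
proof -
  obtain v f where vf: "u = (v, f)"
    by (cases u)
  define F where "F r = blinfun_apply f (\<sigma> r)" for r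
  define w where "w = fst (heis q k' u)"
  have snd: "snd (heis q k' u) = f"
    using u by (simp add: heis_def vf)
  have w: "w = v - (\<Sum>r = 1..nu. F r *\<^sub>R q r)
      + (\<Sum>r = 1..nu. (form (q r) v - (\<Sum>s = 1..nu. gram q k' r s * F s)) *\<^sub>R \<sigma> r)"
    using u by (simp add: heis_def vf F_def w_def)
  have pw: "form (p r) w = form (p r) v - (\<Sum>s = 1..nu. form (p r) (q s) * F s)" for r
    by (simp add: w form_simps form_sum_right[of "p r" "\<lambda>r. F r *\<^sub>R q r"] mult.commute)
  have "heis p k (heis q k' u) = (w - (\<Sum>r = 1..nu. F r *\<^sub>R p r)
      + (\<Sum>r = 1..nu. (form (p r) w - (\<Sum>s = 1..nu. gram p k r s * F s)) *\<^sub>R \<sigma> r), f)"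
    using heis_mem_E[OF u, of q k'] snd by (simp add: heis_def[of p] w_def F_def)
  also have "\<dots> = (v - (\<Sum>r = 1..nu. F r *\<^sub>R (p r + q r))
      + (\<Sum>r = 1..nu. (form (p r + q r) v
           - (\<Sum>s = 1..nu. (gram p k r s + gram q k' r s + form (p r) (q s)) * F s)) *\<^sub>R \<sigma> r), f)"
    unfolding pw
    by (simp add: w form_simps algebra_simps sum.distrib sum_subtractf)
  also have "\<dots> = heis (\<lambda>r. p r + q r) (\<lambda>r s. k r s + k' r s - form (p s) (q r)) u"
    using u by (simp add: heis_def gram_add vf F_def)
  finally show ?thesis .
qed

lemma heis_zero: "heis (\<lambda>_. 0) (\<lambda>_ _. 0) = \<one>\<^bsub>\<G>\<^esub>"
proof -
  have "gram (\<lambda>_. 0) (\<lambda>_ _. 0) = (\<lambda>_ _. 0)"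
    by (intro ext) (simp add: gram_def form_simps)
  then show ?thesis
    unfolding heis_def GL_one by (intro restrict_ext) (simp add: form_simps)
qed

lemma heis_carrier: "heis p k \<in> carrier \<G>"
proof (rule GL_memI)
  let ?q = "\<lambda>r. - p r" and ?k = "\<lambda>r s. - k r s - form (p s) (p r)"
  show "heis p k \<in> extensional E"
    by (simp add: heis_def)
  show "heis p k u \<in> E" "heis ?q ?k u \<in> E" if "u \<in> E" for u
    using that by (simp_all add: heis_mem_E)
  show "heis p k (heis ?q ?k u) = u" "heis ?q ?k (heis p k u) = u" if "u \<in> E" for u
    using that heis_zero by (simp_all add: heis_apply_heis form_simps GL_one)
  show "heis p k (a *\<^sub>R x + b *\<^sub>R y) = a *\<^sub>R heis p k x + b *\<^sub>R heis p k y"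
    if "x \<in> E" "y \<in> E" for x y a b
  proof -
    have "a *\<^sub>R x + b *\<^sub>R y \<in> E"
      using that subspace_E by (simp add: subspace_add subspace_scale)
    then show ?thesis
      using that
      by (simp add: heis_def form_simps plus_blinfun.rep_eq scaleR_blinfun.rep_eq algebra_simps
          sum.distrib sum_subtractf scaleR_sum_right sum_distrib_left)
  qed
qed

text \<open>
  The multiplication law of the unipotent group.  The cocycle \<open>- (p\<^sub>s, q\<^sub>r)\<close>, for \<open>r < s\<close>, vanishes
  whenever the indices that occur in \<open>p\<close> do not exceed those that occur in \<open>q\<close>; this is why ordered
  products have simple parameters.
\<close>

lemma heis_mult:
  "heis p k \<otimes>\<^bsub>\<G>\<^esub> heis q k' = heis (\<lambda>r. p r + q r) (\<lambda>r s. k r s + k' r s - form (p s) (q r))"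
proof (rule GL_eqI)
  show "heis p k \<otimes>\<^bsub>\<G>\<^esub> heis q k' \<in> carrier \<G>"
    by (simp add: heis_carrier)
  show "(heis p k \<otimes>\<^bsub>\<G>\<^esub> heis q k') u
      = heis (\<lambda>r. p r + q r) (\<lambda>r s. k r s + k' r s - form (p s) (q r)) u" if "u \<in> E" for u
    using that by (simp add: GL_mult heis_carrier compose_def heis_apply_heis)
qed (rule heis_carrier)

end

section \<open>Reflections, translations and ordered products of them\<close>

context split_extension begin

lemma refl_op_apply:
  assumes "form \<alpha> \<alpha> = 2" "u \<in> E"
  shows "refl_op form Vd \<alpha> u = (fst u - (form \<alpha> (fst u) + blinfun_apply (snd u) \<alpha>) *\<^sub>R \<alpha>, snd u)"
  using assms form_sym[of \<alpha> "fst u"]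
  by (cases u) (simp add: refl_op_def coroot_def ext_form_def)

lemma refl_op_refl_op:
  assumes "form \<alpha> \<alpha> = 2" "u \<in> E"
  shows "refl_op form Vd \<alpha> u \<in> E" "refl_op form Vd \<alpha> (refl_op form Vd \<alpha> u) = u"
proof -
  show E: "refl_op form Vd \<alpha> u \<in> E"
    using assms by (simp add: refl_op_apply E_iff)
  show "refl_op form Vd \<alpha> (refl_op form Vd \<alpha> u) = u"
    unfolding refl_op_apply[OF assms(1) E]
    using assms by (simp add: refl_op_apply form_simps algebra_simps)
qed

lemma refl_op_carrier:
  assumes "form \<alpha> \<alpha> = 2"
  shows "refl_op form Vd \<alpha> \<in> carrier \<G>"
proof (rule GL_memI[where g = "refl_op form Vd \<alpha>"])
  show "refl_op form Vd \<alpha> \<in> extensional E"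
    by (simp add: refl_op_def)
  fix x y :: "'v \<times> ('v \<Rightarrow>\<^sub>L real)" and a b :: real
  assume xy: "x \<in> E" "y \<in> E"
  then have "a *\<^sub>R x + b *\<^sub>R y \<in> E"
    using subspace_E by (simp add: subspace_add subspace_scale)
  then show "refl_op form Vd \<alpha> (a *\<^sub>R x + b *\<^sub>R y)
      = a *\<^sub>R refl_op form Vd \<alpha> x + b *\<^sub>R refl_op form Vd \<alpha> y"
    using xy assms
    by (simp add: refl_op_apply form_simps plus_blinfun.rep_eq scaleR_blinfun.rep_eq algebra_simps)
qed (rule refl_op_refl_op[OF assms]; assumption)+

lemma refl_op_involution:
  assumes "form \<alpha> \<alpha> = 2"
  shows "refl_op form Vd \<alpha> \<otimes>\<^bsub>\<G>\<^esub> refl_op form Vd \<alpha> = \<one>\<^bsub>\<G>\<^esub>"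
proof (rule GL_eqI)
  show "refl_op form Vd \<alpha> \<otimes>\<^bsub>\<G>\<^esub> refl_op form Vd \<alpha> \<in> carrier \<G>"
    using refl_op_carrier[OF assms] by simp
  show "(refl_op form Vd \<alpha> \<otimes>\<^bsub>\<G>\<^esub> refl_op form Vd \<alpha>) u = \<one>\<^bsub>\<G>\<^esub> u" if "u \<in> E" for u
    using that refl_op_refl_op[OF assms] refl_op_carrier[OF assms]
    by (simp add: GL_mult compose_def GL_one)
qed simp

text \<open>
  Conjugating by the isometry \<open>w\<^sub>\<beta>\<close> moves every \<open>p\<^sub>r\<close> by the reflection in \<open>\<beta>\<close>.  Since \<open>w\<^sub>\<beta>\<close> fixes
  \<open>V\<^sup>0\<close> and the inner products of the \<open>p\<^sub>r\<close> do not change, \<open>k\<close> stays the same.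
\<close>

lemma heis_refl_op:
  assumes "form \<beta> \<beta> = 2" "\<beta> \<in> Vd"
  shows "heis p k \<otimes>\<^bsub>\<G>\<^esub> refl_op form Vd \<beta>
    = refl_op form Vd \<beta> \<otimes>\<^bsub>\<G>\<^esub> heis (\<lambda>r. p r - form (p r) \<beta> *\<^sub>R \<beta>) k"
proof (rule GL_eqI)
  let ?p = "\<lambda>r. p r - form (p r) \<beta> *\<^sub>R \<beta>"
  note [simp] = refl_op_carrier[OF assms(1)] heis_carrier
  show "heis p k \<otimes>\<^bsub>\<G>\<^esub> refl_op form Vd \<beta> \<in> carrier \<G>"
    and "refl_op form Vd \<beta> \<otimes>\<^bsub>\<G>\<^esub> heis ?p k \<in> carrier \<G>"
    by simp_all
  fix u assume u: "u \<in> E"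
  obtain v f where vf: "u = (v, f)"
    by (cases u)
  define F where "F r = blinfun_apply f (\<sigma> r)" for r
  have f\<beta>: "blinfun_apply f \<beta> = 0"
    using u assms by (simp add: vf E_iff)
  have gram: "gram ?p k = gram p k"
    using assms(1) form_sym[of \<beta> "p _"] by (intro ext) (simp add: gram_def form_simps)
  have p\<beta>: "(\<Sum>r = 1..nu. F r *\<^sub>R ?p r) = (\<Sum>r = 1..nu. F r *\<^sub>R p r) - (\<Sum>r = 1..nu. F r * form (p r) \<beta>) *\<^sub>R \<beta>"
    by (simp add: algebra_simps sum_subtractf scaleR_sum_left)
  have lin: "form \<beta> (\<Sum>r = 1..nu. F r *\<^sub>R p r) = (\<Sum>r = 1..nu. F r * form (p r) \<beta>)"
    by (simp add: form_sum_right form_simps form_sym[of \<beta> "p _"])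
  define Z where "Z = (\<Sum>r = 1..nu. (form (p r) v - form (p r) \<beta> * form \<beta> v
      - (\<Sum>s = 1..nu. gram p k r s * F s)) *\<^sub>R \<sigma> r)"
  have "form \<beta> Z = 0"
    by (simp add: Z_def)
  have 1: "heis ?p k u = (v - ((\<Sum>r = 1..nu. F r *\<^sub>R p r) - (\<Sum>r = 1..nu. F r * form (p r) \<beta>) *\<^sub>R \<beta>) + Z, f)"
    using u unfolding p\<beta>[symmetric] by (simp add: heis_def vf gram Z_def F_def form_simps)
  have "refl_op form Vd \<beta> u = (v - form \<beta> v *\<^sub>R \<beta>, f)"
    using u assms(1) f\<beta> by (simp add: refl_op_apply vf)
  then have 2: "heis p k (refl_op form Vd \<beta> u)
      = (v - form \<beta> v *\<^sub>R \<beta> - (\<Sum>r = 1..nu. F r *\<^sub>R p r) + Z, f)"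
    using refl_op_refl_op(1)[OF assms(1) u]
    by (simp add: heis_def F_def Z_def form_simps mult.commute)
  have "heis p k (refl_op form Vd \<beta> u) = refl_op form Vd \<beta> (heis ?p k u)"
    unfolding refl_op_apply[OF assms(1) heis_mem_E[OF u]] 2 unfolding 1
    using assms(1) \<open>form \<beta> Z = 0\<close> f\<beta> by (simp add: form_simps lin algebra_simps)
  then show "(heis p k \<otimes>\<^bsub>\<G>\<^esub> refl_op form Vd \<beta>) u = (refl_op form Vd \<beta> \<otimes>\<^bsub>\<G>\<^esub> heis ?p k) u"
    using u by (simp add: GL_mult compose_def)
qed

text \<open>
  A reflection in a translated root is the reflection in the root itself times the inverse of a \<open>T\<close>
  with subscript \<open>\<beta>\<close> and superscript \<open>\<tau>\<close>.  As \<open>\<tau>\<close> is a combination of several \<open>\<sigma>\<^sub>r\<close>, the parameter \<open>k\<close> of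
  this \<open>T\<close> is in general not zero: it is quadratic in the coefficients of \<open>\<tau>\<close>.
\<close>

lemma refl_op_translate:
  assumes "form \<beta> \<beta> = 2" "\<beta> \<in> Vd" and \<tau>: "\<tau> = (\<Sum>r = 1..nu. a r *\<^sub>R \<sigma> r)"
  shows "form (\<beta> + \<tau>) (\<beta> + \<tau>) = 2"
    and "refl_op form Vd (\<beta> + \<tau>)
      = refl_op form Vd \<beta> \<otimes>\<^bsub>\<G>\<^esub> heis (\<lambda>r. - (a r *\<^sub>R \<beta>)) (\<lambda>r s. - (a r * a s))"
proof -
  let ?h = "heis (\<lambda>r. - (a r *\<^sub>R \<beta>)) (\<lambda>r s. - (a r * a s))"
  have rad: "form x \<tau> = 0" "form \<tau> x = 0" for x
    using form_sym[of \<tau> x] by (simp_all add: \<tau>)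
  show norm: "form (\<beta> + \<tau>) (\<beta> + \<tau>) = 2"
    using assms(1) by (simp add: form_simps rad)
  note [simp] = refl_op_carrier[OF assms(1)] refl_op_carrier[OF norm] heis_carrier
  show "refl_op form Vd (\<beta> + \<tau>) = refl_op form Vd \<beta> \<otimes>\<^bsub>\<G>\<^esub> ?h"
  proof (rule GL_eqI)
    fix u assume u: "u \<in> E"
    obtain v f where vf: "u = (v, f)"
      by (cases u)
    define c where "c = blinfun_apply f \<tau>"
    have c: "(\<Sum>r = 1..nu. a r * blinfun_apply f (\<sigma> r)) = c"
      by (simp add: c_def \<tau> blinfun.sum_right blinfun.scaleR_right)
    have f\<beta>: "blinfun_apply f \<beta> = 0"
      using u assms by (simp add: vf E_iff)
    have gram: "gram (\<lambda>r. - (a r *\<^sub>R \<beta>)) (\<lambda>r s. - (a r * a s)) = (\<lambda>r s. a r * a s)"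
      using assms(1) by (intro ext) (simp add: gram_def form_simps)
    have inner: "(\<Sum>s = 1..nu. a r * a s * blinfun_apply f (\<sigma> s)) = a r * c" for r
      by (simp add: c[symmetric] sum_distrib_left mult.assoc)
    have "(\<Sum>r = 1..nu. blinfun_apply f (\<sigma> r) *\<^sub>R (- (a r *\<^sub>R \<beta>))) = - c *\<^sub>R \<beta>"
      by (simp add: c[symmetric] scaleR_sum_left sum_negf mult.commute)
    moreover have "(\<Sum>r = 1..nu. (form (- (a r *\<^sub>R \<beta>)) v - a r * c) *\<^sub>R \<sigma> r) = - ((form \<beta> v + c) *\<^sub>R \<tau>)"
      by (simp add: \<tau> form_simps scaleR_sum_right algebra_simps sum_negf sum_subtractf sum.distrib)
    ultimately have h: "?h u = (v + c *\<^sub>R \<beta> - (form \<beta> v + c) *\<^sub>R \<tau>, f)"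
      using u by (simp add: heis_def vf gram inner)
    have double: "(x * 2) *\<^sub>R \<beta> = x *\<^sub>R \<beta> + x *\<^sub>R \<beta>" for x
      by (simp flip: scaleR_left_distrib)
    from h have "refl_op form Vd (\<beta> + \<tau>) u = refl_op form Vd \<beta> (?h u)"
      using u heis_mem_E[OF u, of "\<lambda>r. - (a r *\<^sub>R \<beta>)" "\<lambda>r s. - (a r * a s)"] assms(1) norm f\<beta>
      by (simp add: refl_op_apply vf blinfun.add_right form_simps rad c_def algebra_simps double)
    then show "refl_op form Vd (\<beta> + \<tau>) u = (refl_op form Vd \<beta> \<otimes>\<^bsub>\<G>\<^esub> ?h) u"
      using u by (simp add: GL_mult compose_def)
  qed simp_all
qed

lemma T_op_eq_heis:
  assumes "x \<in> Vd" "r \<in> {1..nu}"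
  shows "T_op form Vd x (\<sigma> r) = heis (\<lambda>j. if j = r then x else 0) (\<lambda>_ _. 0)"
  unfolding heis_def T_op_def
proof (rule restrict_ext)
  fix u assume u: "u \<in> E"
  obtain v f where vf: "u = (v, f)"
    by (cases u)
  let ?p = "\<lambda>j. if j = r then x else 0"
  have fx: "blinfun_apply f x = 0"
    using u assms by (simp add: vf E_iff)
  have "gram ?p (\<lambda>_ _. 0) i s = (if i = r then if s = r then form x x / 2 else 0 else 0)" for i s
    by (auto simp: gram_def form_simps)
  then have gram: "(\<Sum>s = 1..nu. gram ?p (\<lambda>_ _. 0) i s * blinfun_apply f (\<sigma> s))
      = (if i = r then form x x / 2 * blinfun_apply f (\<sigma> r) else 0)" for i
    using assms(2) by (simp add: if_distrib[of "\<lambda>y. y * _"] sum.delta cong: if_cong)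
  have "(\<Sum>i = 1..nu. (form (?p i) v - (\<Sum>s = 1..nu. gram ?p (\<lambda>_ _. 0) i s * blinfun_apply f (\<sigma> s))) *\<^sub>R \<sigma> i)
      = (\<Sum>i = 1..nu. if i = r then (form x v - form x x / 2 * blinfun_apply f (\<sigma> r)) *\<^sub>R \<sigma> r else 0)"
    unfolding gram by (rule sum.cong) (simp_all add: form_simps)
  moreover have "(\<Sum>i = 1..nu. blinfun_apply f (\<sigma> i) *\<^sub>R ?p i)
      = (\<Sum>i = 1..nu. if i = r then blinfun_apply f (\<sigma> r) *\<^sub>R x else 0)"
    by (rule sum.cong) simp_all
  ultimately show "u - ext_form form (\<sigma> r, 0) u *\<^sub>R (x, 0) + ext_form form (x, 0) u *\<^sub>R (\<sigma> r, 0)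
      - (form x x / 2 * ext_form form (\<sigma> r, 0) u) *\<^sub>R (\<sigma> r, 0)
    = (fst u - (\<Sum>i = 1..nu. blinfun_apply (snd u) (\<sigma> i) *\<^sub>R ?p i)
       + (\<Sum>i = 1..nu. (form (?p i) (fst u)
           - (\<Sum>s = 1..nu. gram ?p (\<lambda>_ _. 0) i s * blinfun_apply (snd u) (\<sigma> s))) *\<^sub>R \<sigma> i), snd u)"
    using assms(2) fx by (simp add: vf ext_form_def sigma_radical algebra_simps)
qed

lemma c_op_eq_heis:
  assumes "r \<in> {1..nu}" "s \<in> {1..nu}" "r < s"
  shows "c_op form Vd \<sigma> r s = heis (\<lambda>_. 0) (\<lambda>i j. if i = r \<and> j = s then 1 else 0)"
  unfolding heis_def T_op_def c_op_def
proof (rule restrict_ext)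
  fix u assume u: "u \<in> E"
  obtain v f where vf: "u = (v, f)"
    by (cases u)
  let ?k = "\<lambda>i j. if i = r \<and> j = s then 1 else 0"
  have gram: "gram (\<lambda>_. 0) ?k i j
      = (if i = r then if j = s then 1 else 0 else if i = s then if j = r then - 1 else 0 else 0)" for i j
    using assms(3) by (auto simp: gram_def form_simps)
  have inner: "(\<Sum>j = 1..nu. gram (\<lambda>_. 0) ?k i j * blinfun_apply f (\<sigma> j))
      = (if i = r then blinfun_apply f (\<sigma> s) else if i = s then - blinfun_apply f (\<sigma> r) else 0)" for i
    unfolding gram using assms
    by (simp add: if_distrib[of "\<lambda>y. y * _"] sum.delta cong: if_cong)
  have "(\<Sum>i = 1..nu. (form 0 v - (\<Sum>j = 1..nu. gram (\<lambda>_. 0) ?k i j * blinfun_apply f (\<sigma> j))) *\<^sub>R \<sigma> i)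
      = (\<Sum>i = 1..nu. (if i = r then - blinfun_apply f (\<sigma> s) *\<^sub>R \<sigma> r else 0)
           + (if i = s then blinfun_apply f (\<sigma> r) *\<^sub>R \<sigma> s else 0))"
    unfolding inner using assms(3) by (intro sum.cong) (auto simp: form_simps)
  then show "u - ext_form form (\<sigma> s, 0) u *\<^sub>R (\<sigma> r, 0) + ext_form form (\<sigma> r, 0) u *\<^sub>R (\<sigma> s, 0)
      - (form (\<sigma> r) (\<sigma> r) / 2 * ext_form form (\<sigma> s, 0) u) *\<^sub>R (\<sigma> s, 0)
    = (fst u - (\<Sum>i = 1..nu. blinfun_apply (snd u) (\<sigma> i) *\<^sub>R 0)
       + (\<Sum>i = 1..nu. (form 0 (fst u)
           - (\<Sum>j = 1..nu. gram (\<lambda>_. 0) ?k i j * blinfun_apply (snd u) (\<sigma> j))) *\<^sub>R \<sigma> i), snd u)"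
    using assms by (simp add: vf ext_form_def sigma_radical sum.distrib algebra_simps)
qed

lemma T_op_int_pow:
  assumes "x \<in> Vd" "r \<in> {1..nu}"
  shows "T_op form Vd x (\<sigma> r) [^]\<^bsub>\<G>\<^esub> (m::int) = heis (\<lambda>j. if j = r then of_int m *\<^sub>R x else 0) (\<lambda>_ _. 0)"
proof -
  let ?f = "\<lambda>m::int. heis (\<lambda>j. if j = r then of_int m *\<^sub>R x else 0) (\<lambda>_ _. 0)"
  have "?f (a + b) = ?f a \<otimes>\<^bsub>\<G>\<^esub> ?f b" for a b
    unfolding heis_mult by (rule heis_cong) (auto simp: form_simps algebra_simps)
  from GLE.int_pow_of_additive[of ?f, OF heis_carrier this, of m] show ?thesis
    by (simp add: T_op_eq_heis[OF assms] cong: if_cong)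
qed

lemma c_op_int_pow:
  assumes "r \<in> {1..nu}" "s \<in> {1..nu}" "r < s"
  shows "c_op form Vd \<sigma> r s [^]\<^bsub>\<G>\<^esub> (m::int) = heis (\<lambda>_. 0) (\<lambda>i j. if i = r \<and> j = s then of_int m else 0)"
proof -
  let ?f = "\<lambda>m::int. heis (\<lambda>_. 0) (\<lambda>i j. if i = r \<and> j = s then of_int m else 0)"
  have "?f (a + b) = ?f a \<otimes>\<^bsub>\<G>\<^esub> ?f b" for a b
    unfolding heis_mult by (rule heis_cong) (auto simp: form_simps)
  from GLE.int_pow_of_additive[of ?f, OF heis_carrier this, of m] show ?thesis
    by (simp add: c_op_eq_heis[OF assms] cong: if_cong)
qed

lemma ordered_prod_heis_same_index:
  "distinct xs \<Longrightarrow> ordered_prod \<G> (\<lambda>i. heis (\<lambda>j. if j = r then x i else 0) (\<lambda>_ _. 0)) xs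
     = heis (\<lambda>j. if j = r then \<Sum>i\<in>set xs. x i else 0) (\<lambda>_ _. 0)"
proof (induction xs)
  case Nil
  then show ?case
    using heis_zero by (simp cong: if_cong)
next
  case (Cons a xs)
  then show ?case
    by (simp add: heis_mult) (rule heis_cong; auto simp: form_simps)
qed

text \<open>
  No commutator appears, because the first factor has a smaller index than all those after it.
\<close>

lemma ordered_prod_heis_increasing:
  "sorted_wrt (<) xs \<Longrightarrow> ordered_prod \<G> (\<lambda>r. heis (\<lambda>j. if j = r then x r else 0) (\<lambda>_ _. 0)) xs
     = heis (\<lambda>j. if j \<in> set xs then x j else 0) (\<lambda>_ _. 0)"
proof (induction xs)
  case Nil
  then show ?case
    by (simp add: heis_zero)
next
  case (Cons a xs)
  then show ?case
    by (simp add: heis_mult) (rule heis_cong; auto simp: form_simps)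
qed

lemma ordered_prod_heis_central:
  "distinct xs \<Longrightarrow> ordered_prod \<G> (\<lambda>(r, s). heis (\<lambda>_. 0) (\<lambda>i j. if i = r \<and> j = s then k r s else 0)) xs
     = heis (\<lambda>_. 0) (\<lambda>i j. if (i, j) \<in> set xs then k i j else 0)"
proof (induction xs)
  case Nil
  then show ?case
    by (simp add: heis_zero)
next
  case (Cons a xs)
  then show ?case
    by (cases a) (simp add: heis_mult, rule heis_cong; auto simp: form_simps)
qed

end

lemma set_index_pairs: "set (index_pairs nu) = {(r, s). 1 \<le> r \<and> r < s \<and> s \<le> nu}"
  by (force simp: index_pairs_def)

lemma distinct_index_pairs: "distinct (index_pairs nu)"
proof -
  have "distinct (concat (map (\<lambda>r. map (Pair r) [r + 1..<nu + 1]) xs))" if "distinct xs" for xs :: "nat list"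
    using that by (induction xs) (auto simp: distinct_map inj_on_def)
  then show ?thesis
    by (simp add: index_pairs_def)
qed

section \<open>Uniqueness and existence of the factorization\<close>

context split_extension begin

lemma sigma_comb_in_Vd:
  assumes "(\<Sum>r = 1..nu. c r *\<^sub>R \<sigma> r) \<in> Vd" "s \<in> {1..nu}"
  shows "c s = 0"
proof -
  obtain f :: "'v \<Rightarrow>\<^sub>L real" where f: "\<forall>x \<in> Vd. blinfun_apply f x = 0"
      "\<forall>r \<in> {1..nu}. blinfun_apply f (\<sigma> r) = (if r = s then 1 else 0)"
    using dual_functional[OF assms(2)] by blast
  have "0 = blinfun_apply f (\<Sum>r = 1..nu. c r *\<^sub>R \<sigma> r)"
    using f(1) assms(1) by simp
  also have "\<dots> = (\<Sum>r = 1..nu. c r * blinfun_apply f (\<sigma> r))"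
    by (simp add: blinfun.sum_right blinfun.scaleR_right)
  also have "\<dots> = (\<Sum>r = 1..nu. if r = s then c r else 0)"
    using f(2) by (intro sum.cong) simp_all
  finally show ?thesis
    using assms(2) by simp
qed

lemma sigma_comb_eqD:
  assumes "x \<in> Vd" "y \<in> Vd"
    and eq: "x + (\<Sum>r = 1..nu. c r *\<^sub>R \<sigma> r) = y + (\<Sum>r = 1..nu. d r *\<^sub>R \<sigma> r)"
  shows "x = y" and "\<And>r. r \<in> {1..nu} \<Longrightarrow> c r = d r"
proof -
  have "(\<Sum>r = 1..nu. (c r - d r) *\<^sub>R \<sigma> r) = y - x"
    using eq by (simp add: algebra_simps sum_subtractf)
  then have "(\<Sum>r = 1..nu. (c r - d r) *\<^sub>R \<sigma> r) \<in> Vd"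
    using assms subspace_Vd by (simp add: subspace_diff)
  from sigma_comb_in_Vd[OF this] show cd: "c r = d r" if "r \<in> {1..nu}" for r
    using that by simp
  then have "(\<Sum>r = 1..nu. c r *\<^sub>R \<sigma> r) = (\<Sum>r = 1..nu. d r *\<^sub>R \<sigma> r)"
    by (intro sum.cong) simp_all
  with eq show "x = y"
    by simp
qed

text \<open>
  The value at the dual basis vector \<open>\<lambda>\<^sub>s\<close> is \<open>\<lambda>\<^sub>s - p\<^sub>s - \<Sum>\<^sub>r M\<^sub>r\<^sub>s \<sigma>\<^sub>r\<close>.  Splitting it along
  \<open>Vd \<oplus> V\<^sup>0\<close> recovers \<open>p\<^sub>s\<close> and the \<open>s\<close>-th column of \<open>M\<close>.
\<close>

lemma heis_eqD:
  assumes p: "\<And>r. p r \<in> Vd" and q: "\<And>r. q r \<in> Vd" and eq: "heis p k = heis q k'"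
  shows "r \<in> {1..nu} \<Longrightarrow> p r = q r"
    and "r \<in> {1..nu} \<Longrightarrow> s \<in> {1..nu} \<Longrightarrow> r < s \<Longrightarrow> k r s = k' r s"
proof -
  have *: "p s = q s \<and> (\<forall>r\<in>{1..nu}. gram p k r s = gram q k' r s)" if s: "s \<in> {1..nu}" for s
  proof -
    obtain f :: "'v \<Rightarrow>\<^sub>L real" where f: "\<forall>x \<in> Vd. blinfun_apply f x = 0"
        "\<forall>r \<in> {1..nu}. blinfun_apply f (\<sigma> r) = (if r = s then 1 else 0)"
      using dual_functional[OF s] by blast
    have heis_f: "fst (heis p k (0, f)) = - p s + (\<Sum>r = 1..nu. (- gram p k r s) *\<^sub>R \<sigma> r)" for p k
    proof -
      have "(\<Sum>r = 1..nu. blinfun_apply f (\<sigma> r) *\<^sub>R p r) = (\<Sum>r = 1..nu. if r = s then p r else 0)"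
        using f(2) by (intro sum.cong) simp_all
      moreover have "(\<Sum>j = 1..nu. gram p k r j * blinfun_apply f (\<sigma> j))
          = (\<Sum>j = 1..nu. if j = s then gram p k r j else 0)" for r
        using f(2) by (intro sum.cong) simp_all
      ultimately show ?thesis
        using f(1) s by (simp add: heis_def E_iff form_simps)
    qed
    have neg: "- p s \<in> Vd" "- q s \<in> Vd"
      using p q subspace_Vd by (simp_all add: subspace_neg)
    have eq': "- p s + (\<Sum>r = 1..nu. (- gram p k r s) *\<^sub>R \<sigma> r)
        = - q s + (\<Sum>r = 1..nu. (- gram q k' r s) *\<^sub>R \<sigma> r)"
      by (simp only: heis_f[symmetric] eq)
    show ?thesis
      using sigma_comb_eqD(1)[OF neg eq'] sigma_comb_eqD(2)[OF neg eq'] by simp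
  qed
  show "r \<in> {1..nu} \<Longrightarrow> p r = q r"
    using * by blast
  show "k r s = k' r s" if "r \<in> {1..nu}" "s \<in> {1..nu}" "r < s"
  proof -
    have "p r = q r" "p s = q s" "gram p k r s = gram q k' r s"
      using *[OF that(1)] *[OF that(2)] that(1) by blast+
    with that(3) show ?thesis
      by (simp add: gram_def)
  qed
qed

text \<open>
  All that uniqueness needs to know about the finite Weyl group: it acts on \<open>V\<close> alone, preserves \<open>Vd\<close>
  and fixes \<open>V\<^sup>0\<close>.
\<close>

lemma weyl_shape:
  assumes B: "\<And>\<beta>. \<beta> \<in> B \<Longrightarrow> form \<beta> \<beta> = 2 \<and> \<beta> \<in> Vd"
    and h: "h \<in> generate \<G> (refl_op form Vd ` B)"
  shows "\<exists>A. linear A \<and> (\<forall>x\<in>Vd. A x \<in> Vd) \<and> (\<forall>r\<in>{1..nu}. A (\<sigma> r) = \<sigma> r) \<and>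
             (\<forall>u\<in>E. h u = (A (fst u), snd u))"
proof -
  have H: "refl_op form Vd ` B \<subseteq> carrier \<G>"
    using B refl_op_carrier by blast
  have refl: "\<exists>A. linear A \<and> (\<forall>x\<in>Vd. A x \<in> Vd) \<and> (\<forall>r\<in>{1..nu}. A (\<sigma> r) = \<sigma> r) \<and>
             (\<forall>u\<in>E. refl_op form Vd \<beta> u = (A (fst u), snd u))" if "\<beta> \<in> B" for \<beta>
  proof (intro exI conjI ballI)
    let ?A = "\<lambda>x. x - form \<beta> x *\<^sub>R \<beta>"
    show "linear ?A"
      by (rule linearI) (simp_all add: form_simps algebra_simps)
    show "?A x \<in> Vd" if "x \<in> Vd" for x
      using that B[OF \<open>\<beta> \<in> B\<close>] subspace_Vd by (simp add: subspace_diff subspace_scale)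
    show "?A (\<sigma> r) = \<sigma> r" if "r \<in> {1..nu}" for r
      using that by (simp add: radical_sigma)
    show "refl_op form Vd \<beta> u = (?A (fst u), snd u)" if "u \<in> E" for u
      using that B[OF \<open>\<beta> \<in> B\<close>] by (simp add: refl_op_apply E_iff)
  qed
  from h show ?thesis
  proof induction
    case one
    show ?case
      by (rule exI[of _ "\<lambda>x. x"]) (simp add: GL_one linear_ident)
  next
    case (incl h)
    then show ?case using refl by blast
  next
    case (inv h)
    then obtain \<beta> where \<beta>: "\<beta> \<in> B" "h = refl_op form Vd \<beta>"
      by blast
    then have "inv\<^bsub>\<G>\<^esub> h = h"
      using B refl_op_involution refl_op_carrier by (simp add: GLE.inv_equality)
    then show ?case using \<beta> refl by simp
  next
    case (eng h1 h2)
    then obtain A1 A2 where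
        A1: "linear A1" "\<forall>x\<in>Vd. A1 x \<in> Vd" "\<forall>r\<in>{1..nu}. A1 (\<sigma> r) = \<sigma> r" "\<forall>u\<in>E. h1 u = (A1 (fst u), snd u)"
      and A2: "linear A2" "\<forall>x\<in>Vd. A2 x \<in> Vd" "\<forall>r\<in>{1..nu}. A2 (\<sigma> r) = \<sigma> r" "\<forall>u\<in>E. h2 u = (A2 (fst u), snd u)"
      by blast
    have "linear (A1 \<circ> A2)"
      using A2(1) A1(1) by (rule linear_compose)
    moreover have "(h1 \<otimes>\<^bsub>\<G>\<^esub> h2) u = ((A1 \<circ> A2) (fst u), snd u)" if "u \<in> E" for u
      using that A1(4) A2(4) eng(1,2)[THEN GLE.generate_in_carrier[OF H]]
      by (simp add: GL_mult compose_def E_iff)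
    ultimately show ?case
      using A1 A2 by (intro exI[of _ "A1 \<circ> A2"]) (simp add: o_def)
  qed
qed

text \<open>
  A unipotent operator moves each \<open>x \<in> Vd\<close> only by an element of \<open>V\<^sup>0\<close>.  So if \<open>h\<close> in the finite Weyl
  group maps one unipotent operator to another, comparing components in \<open>Vd\<close> shows that \<open>h\<close> fixes
  \<open>Vd\<close>, and it fixes \<open>V\<^sup>0\<close> anyway.
\<close>

lemma weyl_heis_unique:
  assumes B: "\<And>\<beta>. \<beta> \<in> B \<Longrightarrow> form \<beta> \<beta> = 2 \<and> \<beta> \<in> Vd"
    and wd: "wd \<in> generate \<G> (refl_op form Vd ` B)" "wd' \<in> generate \<G> (refl_op form Vd ` B)"
    and eq: "wd \<otimes>\<^bsub>\<G>\<^esub> heis p k = wd' \<otimes>\<^bsub>\<G>\<^esub> heis q k'"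
  shows "wd = wd'" "heis p k = heis q k'"
proof -
  have H: "refl_op form Vd ` B \<subseteq> carrier \<G>"
    using B refl_op_carrier by blast
  note carr = wd[THEN GLE.generate_in_carrier[OF H]]
  interpret W: subgroup "generate \<G> (refl_op form Vd ` B)" \<G>
    by (rule GLE.generate_is_subgroup[OF H])
  define h where "h = inv\<^bsub>\<G>\<^esub> wd' \<otimes>\<^bsub>\<G>\<^esub> wd"
  have h: "h \<in> generate \<G> (refl_op form Vd ` B)"
    using wd by (simp add: h_def)
  have "h \<in> carrier \<G>"
    using carr by (simp add: h_def)
  have "h \<otimes>\<^bsub>\<G>\<^esub> heis p k = inv\<^bsub>\<G>\<^esub> wd' \<otimes>\<^bsub>\<G>\<^esub> (wd' \<otimes>\<^bsub>\<G>\<^esub> heis q k')"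
    using carr heis_carrier by (simp add: h_def GLE.m_assoc flip: eq)
  also have "\<dots> = heis q k'"
    using carr heis_carrier by (simp flip: GLE.m_assoc)
  finally have hh: "h \<otimes>\<^bsub>\<G>\<^esub> heis p k = heis q k'" .
  obtain A where A: "linear A" "\<And>x. x \<in> Vd \<Longrightarrow> A x \<in> Vd" "\<And>r. r \<in> {1..nu} \<Longrightarrow> A (\<sigma> r) = \<sigma> r"
      "\<And>u. u \<in> E \<Longrightarrow> h u = (A (fst u), snd u)"
    using weyl_shape[OF B h] by blast
  have A_comb: "A (\<Sum>r = 1..nu. c r *\<^sub>R \<sigma> r) = (\<Sum>r = 1..nu. c r *\<^sub>R \<sigma> r)" for c
    using A(1,3) by (simp add: linear_sum linear_scale)
  have A_Vd: "A x = x" if x: "x \<in> Vd" for x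
  proof (rule sigma_comb_eqD(1))
    have E: "(x, 0) \<in> E"
      by (simp add: E_iff)
    have heis0: "heis p k (x, 0) = (x + (\<Sum>r = 1..nu. form (p r) x *\<^sub>R \<sigma> r), 0)" for p k
      using E by (simp add: heis_def)
    have "h (heis p k (x, 0)) = heis q k' (x, 0)"
      using fun_cong[OF hh, of "(x, 0)"] E \<open>h \<in> carrier \<G>\<close> heis_carrier by (simp add: GL_mult compose_def)
    then show "A x + (\<Sum>r = 1..nu. form (p r) x *\<^sub>R \<sigma> r) = x + (\<Sum>r = 1..nu. form (q r) x *\<^sub>R \<sigma> r)"
      using heis_mem_E[OF E, of p k] A(1) by (simp add: A(4) heis0 linear_add A_comb)
  qed (use x A in auto)
  have "A x = x" for x
  proof -
    obtain y c where "y \<in> Vd" "x = y + (\<Sum>r = 1..nu. c r *\<^sub>R \<sigma> r)"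
      using decompose by blast
    then show ?thesis
      using A(1) by (simp add: linear_add A_comb A_Vd)
  qed
  then have "h = \<one>\<^bsub>\<G>\<^esub>"
    using \<open>h \<in> carrier \<G>\<close> A(4) GLE.one_closed
    by (intro GL_eqI[where U = E]) (simp_all add: GL_one)
  with hh show "heis p k = heis q k'"
    by (simp add: heis_carrier)
  show "wd = wd'"
    using \<open>h = \<one>\<^bsub>\<G>\<^esub>\<close> carr GLE.inv_solve_left[of "\<one>\<^bsub>\<G>\<^esub>" wd' wd] by (simp add: h_def)
qed

text \<open>
  The products \<open>wd \<otimes> heis p k\<close> with all \<open>p\<^sub>r\<close> in \<open>Q\<close> and \<open>k\<close> in \<open>K\<close> are stable under right
  multiplication by each generating reflection: first \<open>w\<^sub>\<beta>\<close> is moved to the left past \<open>heis p k\<close>, then the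
  two unipotent operators are multiplied.  The assumptions on \<open>K\<close> say that it is closed under addition and
  contains the two kinds of terms which this adds to \<open>k\<close>, the parameter of the translation and the
  cocycle.  Keeping \<open>K\<close> arbitrary lets one argument serve the simple description of the central factor in
  higher rank as well as the delicate one in rank one.
\<close>

lemma weyl_factorization:
  assumes B: "\<And>\<beta>. \<beta> \<in> B \<Longrightarrow> form \<beta> \<beta> = 2 \<and> \<beta> \<in> Vd"
    and Q0: "0 \<in> Q" and Qadd: "\<And>x \<beta> n. x \<in> Q \<Longrightarrow> \<beta> \<in> B \<Longrightarrow> x + of_int n *\<^sub>R \<beta> \<in> Q"
    and Qint: "\<And>x \<beta>. x \<in> Q \<Longrightarrow> \<beta> \<in> B \<Longrightarrow> form x \<beta> \<in> \<int>"
    and H: "\<And>h. h \<in> H \<Longrightarrow> \<exists>\<beta>\<in>B. \<exists>a\<in>L. h = refl_op form Vd (\<beta> + (\<Sum>r = 1..nu. of_int (a r) *\<^sub>R \<sigma> r))"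
    and K0: "(\<lambda>_ _. 0) \<in> K"
    and Kadd: "\<And>k k'. k \<in> K \<Longrightarrow> k' \<in> K \<Longrightarrow> (\<lambda>r s. k r s + k' r s) \<in> K"
    and Kquad: "\<And>a. a \<in> L \<Longrightarrow> (\<lambda>r s. - (of_int (a r) * of_int (a s))) \<in> K"
    and Kcocycle: "\<And>p \<beta> a. (\<And>r. p r \<in> Q) \<Longrightarrow> \<beta> \<in> B \<Longrightarrow> a \<in> L \<Longrightarrow> (\<lambda>r s. of_int (a r) * form (p s) \<beta>) \<in> K"
    and w: "w \<in> generate \<G> H"
  obtains wd p k where "wd \<in> generate \<G> (refl_op form Vd ` B)" "\<And>r. p r \<in> Q" "k \<in> K"
    "w = wd \<otimes>\<^bsub>\<G>\<^esub> heis p k"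
proof -
  let ?W = "generate \<G> (refl_op form Vd ` B)"
  let ?N = "{wd \<otimes>\<^bsub>\<G>\<^esub> heis p k | wd p k. wd \<in> ?W \<and> (\<forall>r. p r \<in> Q) \<and> k \<in> K}"
  have HB: "refl_op form Vd ` B \<subseteq> carrier \<G>"
    using B refl_op_carrier by blast
  note carr = GLE.generate_in_carrier[OF HB]
  have gen: "h \<in> carrier \<G> \<and> h \<otimes>\<^bsub>\<G>\<^esub> h = \<one>\<^bsub>\<G>\<^esub>" if "h \<in> H" for h
  proof -
    from H[OF that] obtain \<beta> a where \<beta>: "\<beta> \<in> B"
      and h: "h = refl_op form Vd (\<beta> + (\<Sum>r = 1..nu. of_int (a r) *\<^sub>R \<sigma> r))"
      by blast
    have "form \<beta> \<beta> = 2" "\<beta> \<in> Vd"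
      using B[OF \<beta>] by auto
    note norm = refl_op_translate(1)[OF this refl, of "\<lambda>r. of_int (a r)"]
    show ?thesis
      unfolding h using refl_op_carrier[OF norm] refl_op_involution[OF norm] by (rule conjI)
  qed
  have "\<one>\<^bsub>\<G>\<^esub> \<otimes>\<^bsub>\<G>\<^esub> w \<in> ?N"
  proof (rule GLE.generate_right_stable[OF gen _ _ w])
    show "?N \<subseteq> carrier \<G>"
      using carr heis_carrier by auto
    have "\<one>\<^bsub>\<G>\<^esub> = \<one>\<^bsub>\<G>\<^esub> \<otimes>\<^bsub>\<G>\<^esub> heis (\<lambda>_. 0) (\<lambda>_ _. 0)"
      by (simp add: heis_zero)
    then show "\<one>\<^bsub>\<G>\<^esub> \<in> ?N"
      using Q0 K0 generate.one[of \<G>] by blast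
    fix x h assume "x \<in> ?N" "h \<in> H"
    then obtain wd p k \<beta> a where x: "x = wd \<otimes>\<^bsub>\<G>\<^esub> heis p k" and wd: "wd \<in> ?W"
      and p: "\<And>r. p r \<in> Q" and k: "k \<in> K" and \<beta>: "\<beta> \<in> B" and a: "a \<in> L"
      and h: "h = refl_op form Vd (\<beta> + (\<Sum>r = 1..nu. of_int (a r) *\<^sub>R \<sigma> r))"
      using H by blast
    \<comment> \<open>\<open>p1\<close> is \<open>p\<close> after \<open>w\<^sub>\<beta>\<close> has moved past it; \<open>p2\<close> and \<open>k2\<close> are the parameters of the product.\<close>
    define p1 where "p1 r = p r - form (p r) \<beta> *\<^sub>R \<beta>" for r
    define p2 where "p2 r = p1 r + - (of_int (a r) *\<^sub>R \<beta>)" for r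
    define k2 where "k2 r s = k r s + - (of_int (a r) * of_int (a s)) + of_int (a r) * form (p1 s) \<beta>" for r s
    let ?s = "refl_op form Vd \<beta>"
    have norm: "form \<beta> \<beta> = 2" "\<beta> \<in> Vd"
      using B \<beta> by auto
    have s: "?s \<in> ?W" "?s \<in> carrier \<G>"
      using \<beta> norm by (simp_all add: generate.incl refl_op_carrier)
    have heis: "heis p1 k \<otimes>\<^bsub>\<G>\<^esub> heis (\<lambda>r. - (of_int (a r) *\<^sub>R \<beta>)) (\<lambda>r s. - (of_int (a r) * of_int (a s))) = heis p2 k2"
      unfolding heis_mult p2_def k2_def by (rule heis_cong) (simp_all add: form_simps)
    have "x \<otimes>\<^bsub>\<G>\<^esub> h = wd \<otimes>\<^bsub>\<G>\<^esub> (heis p k \<otimes>\<^bsub>\<G>\<^esub> ?s) \<otimes>\<^bsub>\<G>\<^esub>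
        heis (\<lambda>r. - (of_int (a r) *\<^sub>R \<beta>)) (\<lambda>r s. - (of_int (a r) * of_int (a s)))"
      unfolding x h refl_op_translate(2)[OF norm refl]
      using carr[OF wd] s heis_carrier by (simp add: GLE.m_assoc)
    also have "\<dots> = (wd \<otimes>\<^bsub>\<G>\<^esub> ?s) \<otimes>\<^bsub>\<G>\<^esub> heis p2 k2"
      unfolding heis_refl_op[OF norm] heis[symmetric] p1_def[symmetric]
      using carr[OF wd] s heis_carrier by (simp add: GLE.m_assoc)
    finally have "x \<otimes>\<^bsub>\<G>\<^esub> h = (wd \<otimes>\<^bsub>\<G>\<^esub> ?s) \<otimes>\<^bsub>\<G>\<^esub> heis p2 k2" .
    moreover have "wd \<otimes>\<^bsub>\<G>\<^esub> ?s \<in> ?W"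
      using wd s(1) by (rule generate.eng)
    moreover have p1: "p1 r \<in> Q" for r
    proof -
      obtain n where "form (p r) \<beta> = of_int n"
        using Qint[OF p \<beta>] by (auto elim: Ints_cases)
      then show ?thesis
        using Qadd[OF p \<beta>, of r "- n"] by (simp add: p1_def)
    qed
    moreover have "p2 r \<in> Q" for r
      using Qadd[OF p1 \<beta>, of r "- a r"] by (simp add: p2_def)
    moreover have "k2 \<in> K"
      unfolding k2_def using Kadd[OF Kadd[OF k Kquad[OF a]] Kcocycle[OF p1 \<beta> a]] by simp
    ultimately show "x \<otimes>\<^bsub>\<G>\<^esub> h \<in> ?N"
      by blast
  qed
  moreover have "w \<in> carrier \<G>"
    using gen w GLE.generate_in_carrier[of H w] by blast
  ultimately show ?thesis
    using that by auto
qed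

end

section \<open>The normal form\<close>

lemma ex1_tripleI:
  assumes "P a b c" and "\<And>a' b' c'. P a b c \<Longrightarrow> P a' b' c' \<Longrightarrow> a = a' \<and> b = b' \<and> c = c'"
  shows "\<exists>!(a, b, c). P a b c"
proof (rule ex1I[of _ "(a, b, c)"])
  show "x = (a, b, c)" if "case x of (a, b, c) \<Rightarrow> P a b c" for x
    using that assms(2)[OF assms(1)] by (cases x) auto
qed (use assms(1) in simp)

text \<open>
  The set \<open>\<Phi>\<close> abstracts the nonzero roots of a simply laced root system, normalized to square length \<open>2\<close>
  and with simple roots \<open>\<alpha>\<close>; \<open>S\<close> is the set of translations, which have integral coordinates in the basis
  \<open>\<sigma>\<close>.  These are written with the representation that also defines the supports.
\<close>

locale simply_laced_extension = split_extension form Vd \<sigma> nu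
  for form :: "'v::euclidean_space \<Rightarrow> 'v \<Rightarrow> real" and Vd \<sigma> nu +
  fixes \<Phi> S :: "'v set" and \<alpha> :: "nat \<Rightarrow> 'v" and l :: nat
  assumes root_norm: "\<beta> \<in> \<Phi> \<Longrightarrow> form \<beta> \<beta> = 2"
    and root_Vd: "\<beta> \<in> \<Phi> \<Longrightarrow> \<beta> \<in> Vd"
    and root_comb: "\<beta> \<in> \<Phi> \<Longrightarrow> \<exists>n :: nat \<Rightarrow> int. \<beta> = (\<Sum>i = 1..l. of_int (n i) *\<^sub>R \<alpha> i)"
    and root_integral: "\<beta> \<in> \<Phi> \<Longrightarrow> \<gamma> \<in> \<Phi> \<Longrightarrow> form \<beta> \<gamma> \<in> \<int>"
    and simple_root: "i \<in> {1..l} \<Longrightarrow> \<alpha> i \<in> \<Phi>"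
    and simple_indep: "(\<Sum>i = 1..l. a i *\<^sub>R \<alpha> i) = (\<Sum>i = 1..l. b i *\<^sub>R \<alpha> i) \<Longrightarrow> i \<in> {1..l} \<Longrightarrow> a i = b i"
    and coordinates: "\<tau> \<in> S \<Longrightarrow>
      (\<Sum>r = 1..nu. of_int (zmod.representation (\<sigma> ` {1..nu}) \<tau> (\<sigma> r)) *\<^sub>R \<sigma> r) = \<tau>"
begin

abbreviation affine_weyl where
  "affine_weyl \<equiv> generate \<G> (refl_op form Vd ` {\<beta> + \<tau> | \<beta> \<tau>. \<beta> \<in> \<Phi> \<and> \<tau> \<in> S})"

abbreviation finite_weyl where
  "finite_weyl \<equiv> generate \<G> (refl_op form Vd ` \<Phi>)"

definition root_lattice :: "'v set" where
  "root_lattice = range (\<lambda>n :: nat \<Rightarrow> int. \<Sum>i = 1..l. of_int (n i) *\<^sub>R \<alpha> i)"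

definition lattice_coords :: "(nat \<Rightarrow> int) set" where
  "lattice_coords = (\<lambda>\<tau> r. zmod.representation (\<sigma> ` {1..nu}) \<tau> (\<sigma> r)) ` S"

lemma root_normed: "\<beta> \<in> \<Phi> \<Longrightarrow> form \<beta> \<beta> = 2 \<and> \<beta> \<in> Vd"
  using root_norm root_Vd by blast

lemma root_lattice_add:
  assumes "x \<in> root_lattice" "\<beta> \<in> \<Phi>"
  shows "x + of_int n *\<^sub>R \<beta> \<in> root_lattice"
proof -
  obtain a b :: "nat \<Rightarrow> int" where
    "x = (\<Sum>i = 1..l. of_int (a i) *\<^sub>R \<alpha> i)" "\<beta> = (\<Sum>i = 1..l. of_int (b i) *\<^sub>R \<alpha> i)"
    using assms root_comb unfolding root_lattice_def by blast
  then have "x + of_int n *\<^sub>R \<beta> = (\<Sum>i = 1..l. of_int (a i + n * b i) *\<^sub>R \<alpha> i)"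
    by (simp add: scaleR_sum_right sum.distrib scaleR_left_distrib)
  then show ?thesis
    unfolding root_lattice_def by (rule range_eqI[of _ _ "\<lambda>i. a i + n * b i"])
qed

lemma root_lattice_integral:
  assumes "x \<in> root_lattice" "\<beta> \<in> \<Phi>"
  shows "form x \<beta> \<in> \<int>"
  using assms(1) root_integral[OF simple_root assms(2)]
  by (auto simp: root_lattice_def form_sum_left form_simps intro!: Ints_sum Ints_mult)

lemma root_lattice_Vd: "x \<in> root_lattice \<Longrightarrow> x \<in> Vd"
  using simple_root root_Vd subspace_Vd
  by (auto simp: root_lattice_def intro!: subspace_sum subspace_scale)

lemma affine_weyl_factorization:
  assumes "(\<lambda>_ _. 0) \<in> K"
    and "\<And>k k'. k \<in> K \<Longrightarrow> k' \<in> K \<Longrightarrow> (\<lambda>r s. k r s + k' r s) \<in> K"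
    and "\<And>a. a \<in> lattice_coords \<Longrightarrow> (\<lambda>r s. - (of_int (a r) * of_int (a s))) \<in> K"
    and "\<And>p \<beta> a. (\<And>r. p r \<in> root_lattice) \<Longrightarrow> \<beta> \<in> \<Phi> \<Longrightarrow> a \<in> lattice_coords \<Longrightarrow>
           (\<lambda>r s. of_int (a r) * form (p s) \<beta>) \<in> K"
    and "w \<in> affine_weyl"
  obtains wd p k where "wd \<in> finite_weyl" "\<And>r. p r \<in> root_lattice" "k \<in> K"
    "w = wd \<otimes>\<^bsub>\<G>\<^esub> heis p k"
proof -
  have zero: "0 \<in> root_lattice"
    unfolding root_lattice_def by (rule range_eqI[of _ _ "\<lambda>_. 0"]) simp
  have gens: "\<exists>\<beta>\<in>\<Phi>. \<exists>a\<in>lattice_coords. h = refl_op form Vd (\<beta> + (\<Sum>r = 1..nu. of_int (a r) *\<^sub>R \<sigma> r))"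
    if h: "h \<in> refl_op form Vd ` {\<beta> + \<tau> | \<beta> \<tau>. \<beta> \<in> \<Phi> \<and> \<tau> \<in> S}" for h
  proof -
    from h obtain \<beta> \<tau> where "\<beta> \<in> \<Phi>" "\<tau> \<in> S" "h = refl_op form Vd (\<beta> + \<tau>)"
      by blast
    then show ?thesis
      unfolding lattice_coords_def by (intro bexI[of _ \<beta>] bexI[OF _ imageI[of \<tau>]]) (simp_all add: coordinates)
  qed
  show thesis
    by (rule weyl_factorization[OF root_normed zero root_lattice_add root_lattice_integral gens assms])
      (assumption | rule that)+
qed

lemma T_op_product:
  "ordered_prod \<G> (\<lambda>r. ordered_prod \<G> (\<lambda>i. T_op form Vd (\<alpha> i) (\<sigma> r) [^]\<^bsub>\<G>\<^esub> (m (i, r) :: int)) [1..<l + 1]) [1..<nu + 1]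
   = heis (\<lambda>r. \<Sum>i = 1..l. of_int (m (i, r)) *\<^sub>R \<alpha> i) (\<lambda>_ _. 0)"
proof -
  have sets: "set [1..<l + 1] = {1..l}" "set [1..<nu + 1] = {1..nu}"
    by auto
  have "ordered_prod \<G> (\<lambda>i. T_op form Vd (\<alpha> i) (\<sigma> r) [^]\<^bsub>\<G>\<^esub> m (i, r)) [1..<l + 1]
      = heis (\<lambda>j. if j = r then \<Sum>i = 1..l. of_int (m (i, r)) *\<^sub>R \<alpha> i else 0) (\<lambda>_ _. 0)"
    if r: "r \<in> {1..nu}" for r
  proof -
    have "ordered_prod \<G> (\<lambda>i. T_op form Vd (\<alpha> i) (\<sigma> r) [^]\<^bsub>\<G>\<^esub> m (i, r)) [1..<l + 1]
        = ordered_prod \<G> (\<lambda>i. heis (\<lambda>j. if j = r then of_int (m (i, r)) *\<^sub>R \<alpha> i else 0) (\<lambda>_ _. 0)) [1..<l + 1]"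
      using simple_root root_Vd r by (intro ordered_prod_cong T_op_int_pow) auto
    then show ?thesis
      using sets by (simp only: ordered_prod_heis_same_index[OF distinct_upt])
  qed
  then have "ordered_prod \<G> (\<lambda>r. ordered_prod \<G> (\<lambda>i. T_op form Vd (\<alpha> i) (\<sigma> r) [^]\<^bsub>\<G>\<^esub> m (i, r)) [1..<l + 1]) [1..<nu + 1]
      = ordered_prod \<G> (\<lambda>r. heis (\<lambda>j. if j = r then \<Sum>i = 1..l. of_int (m (i, r)) *\<^sub>R \<alpha> i else 0) (\<lambda>_ _. 0)) [1..<nu + 1]"
    by (intro ordered_prod_cong) auto
  also have "\<dots> = heis (\<lambda>j. if j \<in> set [1..<nu + 1] then \<Sum>i = 1..l. of_int (m (i, j)) *\<^sub>R \<alpha> i else 0) (\<lambda>_ _. 0)"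
    by (rule ordered_prod_heis_increasing) simp
  also have "\<dots> = heis (\<lambda>r. \<Sum>i = 1..l. of_int (m (i, r)) *\<^sub>R \<alpha> i) (\<lambda>_ _. 0)"
    by (rule heis_cong) auto
  finally show ?thesis .
qed

lemma c_op_product:
  "ordered_prod \<G> (\<lambda>(r, s). c_op form Vd \<sigma> r s [^]\<^bsub>\<G>\<^esub> (k (r, s) :: int)) (index_pairs nu)
   = heis (\<lambda>_. 0) (\<lambda>r s. of_int (k (r, s)))"
proof -
  have "ordered_prod \<G> (\<lambda>(r, s). c_op form Vd \<sigma> r s [^]\<^bsub>\<G>\<^esub> k (r, s)) (index_pairs nu)
      = ordered_prod \<G> (\<lambda>(r, s). heis (\<lambda>_. 0) (\<lambda>i j. if i = r \<and> j = s then of_int (k (r, s)) else 0)) (index_pairs nu)"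
    by (rule ordered_prod_cong) (auto simp: set_index_pairs intro!: c_op_int_pow)
  also have "\<dots> = heis (\<lambda>_. 0) (\<lambda>i j. if (i, j) \<in> set (index_pairs nu) then of_int (k (i, j)) else 0)"
    using ordered_prod_heis_central[OF distinct_index_pairs, of "\<lambda>r s. of_int (k (r, s))"] .
  also have "\<dots> = heis (\<lambda>_. 0) (\<lambda>r s. of_int (k (r, s)))"
    by (rule heis_cong) (auto simp: set_index_pairs)
  finally show ?thesis .
qed

text \<open>
  The exponents in the normal form are exactly the coordinates of the parameters, so both existence and
  uniqueness become statements about factorizations \<open>wd \<otimes> heis p k\<close>.
\<close>

lemma normal_form_eq_heis:
  assumes "wd \<in> finite_weyl"
  shows "wd \<otimes>\<^bsub>\<G>\<^esub> ordered_prod \<G> (\<lambda>r. ordered_prod \<G>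
            (\<lambda>i. T_op form Vd (\<alpha> i) (\<sigma> r) [^]\<^bsub>\<G>\<^esub> (m (i, r) :: int)) [1..<l + 1]) [1..<nu + 1]
          \<otimes>\<^bsub>\<G>\<^esub> ordered_prod \<G> (\<lambda>(r, s). c_op form Vd \<sigma> r s [^]\<^bsub>\<G>\<^esub> (k (r, s) :: int)) (index_pairs nu)
      = wd \<otimes>\<^bsub>\<G>\<^esub> heis (\<lambda>r. \<Sum>i = 1..l. of_int (m (i, r)) *\<^sub>R \<alpha> i) (\<lambda>r s. of_int (k (r, s)))"
proof -
  have "wd \<in> carrier \<G>"
    using assms root_normed refl_op_carrier GLE.generate_in_carrier[of "refl_op form Vd ` \<Phi>"] by blast
  then show ?thesis
    unfolding T_op_product c_op_product by (simp add: GLE.m_assoc heis_carrier heis_mult form_simps)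
qed

lemma comb_in_Vd: "(\<Sum>i = 1..l. of_int (n i) *\<^sub>R \<alpha> i) \<in> Vd"
  by (rule root_lattice_Vd) (auto simp: root_lattice_def)

text \<open>
  The factorization applies with all integral families \<open>k\<close>, as every term added to \<open>k\<close> is an integer.
\<close>

theorem weyl_normal_form:
  assumes w: "w \<in> affine_weyl"
  shows "\<exists>!(wd, m, k). wd \<in> finite_weyl \<and>
            m \<in> {1..l} \<times> {1..nu} \<rightarrow>\<^sub>E (UNIV :: int set) \<and>
            k \<in> {(r, s). 1 \<le> r \<and> r < s \<and> s \<le> nu} \<rightarrow>\<^sub>E (UNIV :: int set) \<and>
            w = wd \<otimes>\<^bsub>\<G>\<^esub> ordered_prod \<G> (\<lambda>r. ordered_prod \<G>
                     (\<lambda>i. T_op form Vd (\<alpha> i) (\<sigma> r) [^]\<^bsub>\<G>\<^esub> m (i, r)) [1..<l + 1]) [1..<nu + 1]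
                \<otimes>\<^bsub>\<G>\<^esub> ordered_prod \<G> (\<lambda>(r, s). c_op form Vd \<sigma> r s [^]\<^bsub>\<G>\<^esub> k (r, s)) (index_pairs nu)"
    (is "\<exists>!(wd, m, k). ?P wd m k")
proof -
  let ?I = "{1..l} \<times> {1..nu}" and ?J = "{(r, s). 1 \<le> r \<and> r < s \<and> s \<le> nu}"
  let ?p = "\<lambda>(m :: nat \<times> nat \<Rightarrow> int) r. \<Sum>i = 1..l. of_int (m (i, r)) *\<^sub>R \<alpha> i"
  let ?k = "\<lambda>(k :: nat \<times> nat \<Rightarrow> int) r s. of_int (k (r, s)) :: real"
  have P: "?P wd m k \<longleftrightarrow> wd \<in> finite_weyl \<and> m \<in> ?I \<rightarrow>\<^sub>E UNIV \<and> k \<in> ?J \<rightarrow>\<^sub>E UNIV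
      \<and> w = wd \<otimes>\<^bsub>\<G>\<^esub> heis (?p m) (?k k)" for wd m k
    by (simp only: normal_form_eq_heis[of wd m k] cong: conj_cong)
  have unique: "wd = wd' \<and> m = m' \<and> k = k'" if "?P wd m k" "?P wd' m' k'" for wd wd' m m' k k'
  proof -
    have eq: "wd \<otimes>\<^bsub>\<G>\<^esub> heis (?p m) (?k k) = wd' \<otimes>\<^bsub>\<G>\<^esub> heis (?p m') (?k k')"
      and wd: "wd \<in> finite_weyl" "wd' \<in> finite_weyl"
      and ext: "m \<in> ?I \<rightarrow>\<^sub>E UNIV" "m' \<in> ?I \<rightarrow>\<^sub>E UNIV" "k \<in> ?J \<rightarrow>\<^sub>E UNIV" "k' \<in> ?J \<rightarrow>\<^sub>E UNIV"
      using that unfolding P by auto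
    have u: "wd = wd'" "heis (?p m) (?k k) = heis (?p m') (?k k')"
      by (rule weyl_heis_unique[OF _ wd eq]; rule root_normed; assumption)+
    note h = heis_eqD[OF comb_in_Vd comb_in_Vd u(2)]
    have "m (i, r) = m' (i, r)" if "i \<in> {1..l}" "r \<in> {1..nu}" for i r
      using simple_indep[OF h(1)[OF that(2)] that(1)] by simp
    then have "m = m'"
      using ext by (intro PiE_ext[of m ?I]) auto
    moreover have "k (r, s) = k' (r, s)" if "1 \<le> r" "r < s" "s \<le> nu" for r s
      using h(2)[of r s] that by simp
    then have "k = k'"
      using ext by (intro PiE_ext[of k ?J]) auto
    ultimately show ?thesis
      using u(1) by blast
  qed
  obtain wd p k where wd: "wd \<in> finite_weyl" and p: "\<And>r. p r \<in> root_lattice"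
    and k: "k \<in> {k. \<forall>r s. k r s \<in> \<int>}" and w_eq: "w = wd \<otimes>\<^bsub>\<G>\<^esub> heis p k"
  proof (rule affine_weyl_factorization[OF _ _ _ _ w, of "{k. \<forall>r s. k r s \<in> \<int>}"])
    show "(\<lambda>r s. of_int (a r) * form (p s) \<beta>) \<in> {k. \<forall>r s. k r s \<in> \<int>}"
      if "\<And>r. p r \<in> root_lattice" "\<beta> \<in> \<Phi>" for p \<beta> and a :: "nat \<Rightarrow> int"
      using root_lattice_integral that by auto
  qed auto
  have "\<exists>n :: nat \<Rightarrow> int. p r = (\<Sum>i = 1..l. of_int (n i) *\<^sub>R \<alpha> i)" for r
    using p[of r] by (auto simp: root_lattice_def)
  then obtain n :: "nat \<Rightarrow> nat \<Rightarrow> int" where n: "\<And>r. p r = (\<Sum>i = 1..l. of_int (n r i) *\<^sub>R \<alpha> i)"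
    by metis
  have "heis p k = heis (?p (\<lambda>(i, r) \<in> ?I. n r i)) (?k (\<lambda>(r, s) \<in> ?J. \<lfloor>k r s\<rfloor>))"
    by (rule heis_cong) (use k in \<open>auto simp: n intro!: sum.cong\<close>)
  then have "?P wd (\<lambda>(i, r) \<in> ?I. n r i) (\<lambda>(r, s) \<in> ?J. \<lfloor>k r s\<rfloor>)"
    unfolding P using wd w_eq by (auto simp: restrict_PiE_iff)
  then show ?thesis
    using unique by (rule ex1_tripleI[of ?P wd "\<lambda>(i, r) \<in> ?I. n r i" "\<lambda>(r, s) \<in> ?J. \<lfloor>k r s\<rfloor>"])
qed

end

section \<open>The central factor in rank one\<close>

context simply_laced_extension begin

abbreviation central :: "(nat \<Rightarrow> nat \<Rightarrow> real) \<Rightarrow> 'v \<times> ('v \<Rightarrow>\<^sub>L real) \<Rightarrow> 'v \<times> ('v \<Rightarrow>\<^sub>L real)" where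
  "central \<equiv> heis (\<lambda>_. 0)"

abbreviation F where "F \<equiv> F_group form Vd S \<sigma> nu"

lemma central_mult: "central k \<otimes>\<^bsub>\<G>\<^esub> central k' = central (\<lambda>r s. k r s + k' r s)"
  unfolding heis_mult by (rule heis_cong) (simp_all add: form_simps)

lemma subgroup_central: "subgroup (range central) \<G>"
proof (rule GLE.subgroupI)
  show "range central \<subseteq> carrier \<G>"
    using heis_carrier by blast
  show "inv\<^bsub>\<G>\<^esub> z \<in> range central" if "z \<in> range central" for z
  proof -
    from that obtain k where z: "z = central k"
      by blast
    have "central (\<lambda>r s. - k r s) \<otimes>\<^bsub>\<G>\<^esub> z = \<one>\<^bsub>\<G>\<^esub>"
      unfolding z central_mult by (simp add: heis_zero)
    then have "inv\<^bsub>\<G>\<^esub> z = central (\<lambda>r s. - k r s)"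
      by (rule GLE.inv_equality) (simp_all add: z heis_carrier)
    then show ?thesis
      by blast
  qed
qed (auto simp: central_mult)

lemma z_op_supported:
  assumes "J \<in> supp_class \<sigma> nu S"
  shows "z_op form Vd S \<sigma> nu J = central (\<lambda>i j. if i \<in> J \<and> j \<in> J then 1 else 0)"
proof -
  let ?xs = "filter (\<lambda>(r, s). r \<in> J \<and> s \<in> J) (index_pairs nu)"
  have "z_op form Vd S \<sigma> nu J = ordered_prod \<G> (\<lambda>(r, s). c_op form Vd \<sigma> r s) ?xs"
    using assms by (simp add: z_op_def)
  also have "\<dots> = ordered_prod \<G> (\<lambda>(r, s). central (\<lambda>i j. if i = r \<and> j = s then 1 else 0)) ?xs"
    by (rule ordered_prod_cong) (auto simp: set_index_pairs intro!: c_op_eq_heis)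
  also have "\<dots> = central (\<lambda>i j. if (i, j) \<in> set ?xs then 1 else 0)"
    using ordered_prod_heis_central[of ?xs "\<lambda>_ _. 1"] distinct_index_pairs by simp
  also have "\<dots> = central (\<lambda>i j. if i \<in> J \<and> j \<in> J then 1 else 0)"
    by (rule heis_cong) (auto simp: set_index_pairs)
  finally show ?thesis .
qed

lemma z_op_unsupported_pair:
  assumes "{r, s} \<notin> supp_class \<sigma> nu S" "r \<in> {1..nu}" "s \<in> {1..nu}" "r < s"
  shows "z_op form Vd S \<sigma> nu {r, s} = central (\<lambda>i j. if i = r \<and> j = s then 2 else 0)"
proof -
  have "Min {r, s} = r" "Max {r, s} = s" "card {r, s} = 2"
    using assms(4) by simp_all
  then have "z_op form Vd S \<sigma> nu {r, s} = c_op form Vd \<sigma> r s [^]\<^bsub>\<G>\<^esub> (2 :: int)"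
    using assms(1) int_pow_int[of \<G> _ 2] by (simp add: z_op_def)
  then show ?thesis
    by (simp add: c_op_int_pow[OF assms(2-4)] cong: if_cong)
qed

lemma z_op_central: "J \<subseteq> {1..nu} \<Longrightarrow> z_op form Vd S \<sigma> nu J \<in> range central"
proof -
  assume J: "J \<subseteq> {1..nu}"
  consider "J \<in> supp_class \<sigma> nu S" | "J \<notin> supp_class \<sigma> nu S" "card J = 2"
    | "J \<notin> supp_class \<sigma> nu S" "card J \<noteq> 2"
    by blast
  then show ?thesis
  proof cases
    case 1
    then show ?thesis
      using z_op_supported by blast
  next
    case 2
    then obtain x y where "J = {x, y}" "x \<noteq> y"
      by (auto simp: card_2_iff)
    then obtain r s where "J = {r, s}" "r < s"
      by (metis insert_commute linorder_neqE_nat)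
    then show ?thesis
      using 2 J z_op_unsupported_pair[of r s] by simp
  next
    case 3
    then have "z_op form Vd S \<sigma> nu J = \<one>\<^bsub>\<G>\<^esub>"
      by (simp add: z_op_def)
    then show ?thesis
      by (simp flip: heis_zero)
  qed
qed

lemma F_central: "F \<subseteq> range central"
  unfolding F_group_def
  by (rule GLE.generate_subgroup_incl[OF _ subgroup_central]) (use z_op_central in blast)

lemma subgroup_F: "subgroup F \<G>"
proof -
  have "z_op form Vd S \<sigma> nu ` Pow {1..nu} \<subseteq> range central"
    using z_op_central by blast
  also have "\<dots> \<subseteq> carrier \<G>"
    using subgroup_central by (rule subgroup.subset)
  finally show ?thesis
    unfolding F_group_def by (rule GLE.generate_is_subgroup)
qed

lemma z_op_in_F: "J \<subseteq> {1..nu} \<Longrightarrow> z_op form Vd S \<sigma> nu J \<in> F"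
  unfolding F_group_def by (rule generate.incl) blast

text \<open>
  Every \<open>c\<^sub>r\<^sub>s\<close> has its square in \<open>F\<close>: either \<open>{r, s}\<close> is in the supporting class and \<open>c\<^sub>r\<^sub>s\<close> itself is a
  generator, or its square is one.
\<close>

lemma even_central_in_F:
  fixes n :: "nat \<Rightarrow> nat \<Rightarrow> int"
  shows "central (\<lambda>r s. 2 * of_int (n r s)) \<in> F"
proof -
  interpret F: subgroup F \<G>
    by (rule subgroup_F)
  have square: "central (\<lambda>i j. if i = r \<and> j = s then 2 else 0) \<in> F"
    if rs: "r \<in> {1..nu}" "s \<in> {1..nu}" "r < s" for r s
  proof (cases "{r, s} \<in> supp_class \<sigma> nu S")
    case True
    then have "central (\<lambda>i j. if i \<in> {r, s} \<and> j \<in> {r, s} then 1 else 0) \<in> F"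
      using z_op_in_F[of "{r, s}"] z_op_supported[OF True] rs by simp
    from F.m_closed[OF this this]
    have "central (\<lambda>i j. (if i \<in> {r, s} \<and> j \<in> {r, s} then 1 else 0)
        + (if i \<in> {r, s} \<and> j \<in> {r, s} then 1 else 0)) \<in> F"
      unfolding central_mult .
    also have "central (\<lambda>i j. (if i \<in> {r, s} \<and> j \<in> {r, s} then 1 else 0)
        + (if i \<in> {r, s} \<and> j \<in> {r, s} then 1 else 0)) = central (\<lambda>i j. if i = r \<and> j = s then 2 else 0)"
      by (rule heis_cong) (use rs in auto)
    finally show ?thesis .
  next
    case False
    then show ?thesis
      using z_op_in_F[of "{r, s}"] z_op_unsupported_pair[OF False rs] rs by simp
  qed
  have single: "central (\<lambda>i j. if i = r \<and> j = s then 2 * of_int (n r s) else 0) \<in> F"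
    if rs: "r \<in> {1..nu}" "s \<in> {1..nu}" "r < s" for r s
  proof -
    let ?f = "\<lambda>m::int. central (\<lambda>i j. if i = r \<and> j = s then 2 * of_int m else 0)"
    have "?f (a + b) = ?f a \<otimes>\<^bsub>\<G>\<^esub> ?f b" for a b
      unfolding central_mult by (rule heis_cong) auto
    from GLE.int_pow_of_additive[of ?f, OF heis_carrier this, of "n r s"]
    have "central (\<lambda>i j. if i = r \<and> j = s then 2 else 0) [^]\<^bsub>\<G>\<^esub> n r s = ?f (n r s)"
      by (simp cong: if_cong)
    then show ?thesis
      using GLE.subgroup_int_pow_closed[OF subgroup_F square[OF rs], of "n r s"] by simp
  qed
  have "ordered_prod \<G> (\<lambda>(r, s). central (\<lambda>i j. if i = r \<and> j = s then 2 * of_int (n r s) else 0)) (index_pairs nu) \<in> F"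
    by (rule F.ordered_prod_mem) (auto simp: set_index_pairs intro!: single)
  also have "ordered_prod \<G> (\<lambda>(r, s). central (\<lambda>i j. if i = r \<and> j = s then 2 * of_int (n r s) else 0)) (index_pairs nu)
      = central (\<lambda>i j. if (i, j) \<in> set (index_pairs nu) then 2 * of_int (n i j) else 0)"
    using ordered_prod_heis_central[OF distinct_index_pairs, of "\<lambda>r s. 2 * of_int (n r s)"] .
  also have "\<dots> = central (\<lambda>r s. 2 * of_int (n r s))"
    by (rule heis_cong) (auto simp: set_index_pairs)
  finally show ?thesis .
qed

text \<open>
  Modulo \<open>2\<close>, the product \<open>a\<^sub>r a\<^sub>s\<close> is \<open>1\<close> exactly when \<open>r\<close> and \<open>s\<close> both lie in the support \<open>J\<close> of the
  translation \<open>a\<close>.  So the operator differs from the generator \<open>z\<^sub>J\<close> by one with even parameters.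
  This is where the definition of the \<open>z\<^sub>J\<close> comes from.
\<close>

lemma quadratic_central_in_F:
  assumes "a \<in> lattice_coords"
  shows "central (\<lambda>r s. - (of_int (a r) * of_int (a s))) \<in> F"
proof -
  interpret F: subgroup F \<G>
    by (rule subgroup_F)
  define J where "J = {r \<in> {1..nu}. odd (a r)}"
  from assms obtain \<tau> where "\<tau> \<in> S" "a = (\<lambda>r. zmod.representation (\<sigma> ` {1..nu}) \<tau> (\<sigma> r))"
    by (auto simp: lattice_coords_def)
  then have "J = supp \<sigma> nu \<tau>" "\<tau> \<in> S"
    by (simp_all add: J_def supp_def)
  then have J: "J \<in> supp_class \<sigma> nu S"
    by (simp add: supp_class_def)
  define e :: "nat \<Rightarrow> nat \<Rightarrow> int" where "e r s = (if r \<in> J \<and> s \<in> J then 1 else 0)" for r s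
  define n where "n r s = (- (a r * a s) - e r s) div 2" for r s
  have n: "- (a r * a s) = e r s + 2 * n r s" if "r \<in> {1..nu}" "s \<in> {1..nu}" for r s
  proof -
    have "even (- (a r * a s) - e r s)"
      using that by (auto simp: e_def J_def)
    then show ?thesis
      by (simp add: n_def)
  qed
  have "central (\<lambda>i j. if i \<in> J \<and> j \<in> J then 1 else 0) \<in> F"
    using z_op_in_F[of J] z_op_supported[OF J] by (simp add: J_def subset_iff)
  from F.m_closed[OF this even_central_in_F[of n]]
  have "central (\<lambda>r s. (if r \<in> J \<and> s \<in> J then 1 else 0) + 2 * of_int (n r s)) \<in> F"
    unfolding central_mult .
  also have "central (\<lambda>r s. (if r \<in> J \<and> s \<in> J then 1 else 0) + 2 * of_int (n r s))
      = central (\<lambda>r s. - (of_int (a r) * of_int (a s)))"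
  proof (rule heis_cong)
    fix r s assume "r \<in> {1..nu}" "s \<in> {1..nu}"
    then have "real_of_int (- (a r * a s)) = of_int (e r s + 2 * n r s)"
      by (simp only: n)
    then show "(if r \<in> J \<and> s \<in> J then 1 else 0) + 2 * real_of_int (n r s) = - (of_int (a r) * of_int (a s))"
      by (simp add: e_def split: if_splits)
  qed simp
  finally show ?thesis .
qed

lemma rank_one_lattice:
  assumes "l = 1" "x \<in> root_lattice"
  shows "\<exists>n :: int. x = of_int n *\<^sub>R \<alpha> 1"
  using assms(2) unfolding root_lattice_def by (auto simp: assms(1))

lemma rank_one_roots:
  assumes l: "l = 1" and \<beta>: "\<beta> \<in> \<Phi>"
  shows "\<beta> = \<alpha> 1 \<or> \<beta> = - \<alpha> 1"
proof -
  obtain n :: "nat \<Rightarrow> int" where n: "\<beta> = of_int (n 1) *\<^sub>R \<alpha> 1"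
    using root_comb[OF \<beta>] l by auto
  have "form (\<alpha> 1) (\<alpha> 1) = 2"
    using root_norm simple_root l by simp
  then have "2 * (of_int (n 1) * of_int (n 1)) = (2::real)"
    using root_norm[OF \<beta>] by (simp add: n form_simps)
  then have "of_int (n 1 * n 1) = (1::real)"
    by simp
  then have "n 1 * n 1 = 1"
    by (simp only: of_int_eq_1_iff)
  then have "n 1 = 1 \<or> n 1 = - 1"
    by (simp add: zmult_eq_1_iff)
  then show ?thesis
    using n by auto
qed

lemma rank_one_weyl:
  assumes l: "l = 1" and w: "w \<in> finite_weyl"
  shows "\<exists>n \<in> {0, 1}. w = refl_op form Vd (\<alpha> 1) [^]\<^bsub>\<G>\<^esub> (n :: nat)"
proof -
  let ?s = "refl_op form Vd (\<alpha> 1)"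
  have norm: "form (\<alpha> 1) (\<alpha> 1) = 2"
    using root_norm simple_root l by simp
  note s = refl_op_carrier[OF norm]
  have neg: "refl_op form Vd (- \<alpha> 1) = ?s"
    using norm by (simp add: refl_op_def coroot_def ext_form_def form_simps blinfun.minus_right fun_eq_iff)
      (simp add: algebra_simps)
  have gen: "h \<in> carrier \<G> \<and> h \<otimes>\<^bsub>\<G>\<^esub> h = \<one>\<^bsub>\<G>\<^esub>" if "h \<in> refl_op form Vd ` \<Phi>" for h
    using that refl_op_carrier refl_op_involution root_norm by auto
  have "\<one>\<^bsub>\<G>\<^esub> \<otimes>\<^bsub>\<G>\<^esub> w \<in> {\<one>\<^bsub>\<G>\<^esub>, ?s}"
  proof (rule GLE.generate_right_stable[OF gen _ _ w])
    show "x \<otimes>\<^bsub>\<G>\<^esub> h \<in> {\<one>\<^bsub>\<G>\<^esub>, ?s}" if "x \<in> {\<one>\<^bsub>\<G>\<^esub>, ?s}" "h \<in> refl_op form Vd ` \<Phi>" for x h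
    proof -
      have "h = ?s"
        using that(2) rank_one_roots[OF l] neg by auto
      then show ?thesis
        using that(1) s refl_op_involution[OF norm] by auto
    qed
  qed (use s in auto)
  moreover have "w \<in> carrier \<G>"
    using gen w GLE.generate_in_carrier[of "refl_op form Vd ` \<Phi>" w] by blast
  ultimately have "w = \<one>\<^bsub>\<G>\<^esub> \<or> w = ?s"
    by simp
  then show ?thesis
    using s GLE.pow_one[OF s] by auto
qed

text \<open>
  In rank one the root lattice is spanned by a vector of square length \<open>2\<close>, so all cocycle terms are even.
\<close>

lemma rank_one_central_in_F:
  assumes l: "l = 1" and p: "\<And>r. p r \<in> root_lattice" and \<beta>: "\<beta> \<in> \<Phi>"
  shows "central (\<lambda>r s. of_int (a r) * form (p s) \<beta>) \<in> F"
proof -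
  have norm: "form (\<alpha> 1) (\<alpha> 1) = 2"
    using root_norm simple_root l by simp
  have "\<exists>n :: int. p s = of_int n *\<^sub>R \<alpha> 1" for s
    using rank_one_lattice[OF l p] .
  then obtain n :: "nat \<Rightarrow> int" where n: "\<And>s. p s = of_int (n s) *\<^sub>R \<alpha> 1"
    by metis
  obtain e :: int where e: "\<beta> = of_int e *\<^sub>R \<alpha> 1"
    using rank_one_roots[OF l \<beta>] by (metis of_int_1 of_int_minus scaleR_minus1_left scaleR_one)
  have "(\<lambda>r s. of_int (a r) * form (p s) \<beta>) = (\<lambda>r s. 2 * of_int (a r * n s * e))"
    by (intro ext) (simp add: n e form_simps norm)
  then show ?thesis
    using even_central_in_F[of "\<lambda>r s. a r * n s * e"] by simp
qed

lemma rank_one_normal_form_eq_heis: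
  assumes l: "l = 1"
  shows "refl_op form Vd (\<alpha> 1) [^]\<^bsub>\<G>\<^esub> (n :: nat)
      \<otimes>\<^bsub>\<G>\<^esub> ordered_prod \<G> (\<lambda>r. T_op form Vd (\<alpha> 1) (\<sigma> r) [^]\<^bsub>\<G>\<^esub> (m r :: int)) [1..<nu + 1]
      \<otimes>\<^bsub>\<G>\<^esub> central k
    = refl_op form Vd (\<alpha> 1) [^]\<^bsub>\<G>\<^esub> n \<otimes>\<^bsub>\<G>\<^esub> heis (\<lambda>r. of_int (m r) *\<^sub>R \<alpha> 1) k"
proof -
  have norm: "form (\<alpha> 1) (\<alpha> 1) = 2"
    using root_norm simple_root l by simp
  have "ordered_prod \<G> (\<lambda>r. T_op form Vd (\<alpha> 1) (\<sigma> r) [^]\<^bsub>\<G>\<^esub> m r) [1..<nu + 1]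
      = ordered_prod \<G> (\<lambda>r. ordered_prod \<G> (\<lambda>i. T_op form Vd (\<alpha> i) (\<sigma> r) [^]\<^bsub>\<G>\<^esub> m r) [1..<l + 1]) [1..<nu + 1]"
  proof (rule ordered_prod_cong)
    fix r assume "r \<in> set [1..<nu + 1]"
    then have "T_op form Vd (\<alpha> 1) (\<sigma> r) \<in> carrier \<G>"
      using simple_root root_Vd l by (simp add: T_op_eq_heis heis_carrier)
    moreover have "[1..<l + 1] = [1]"
      by (simp add: l upt_rec)
    ultimately show "T_op form Vd (\<alpha> 1) (\<sigma> r) [^]\<^bsub>\<G>\<^esub> m r
        = ordered_prod \<G> (\<lambda>i. T_op form Vd (\<alpha> i) (\<sigma> r) [^]\<^bsub>\<G>\<^esub> m r) [1..<l + 1]"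
      by simp
  qed
  also have "\<dots> = heis (\<lambda>r. of_int (m r) *\<^sub>R \<alpha> 1) (\<lambda>_ _. 0)"
    using T_op_product[of "\<lambda>(i, r). m r"] l by simp
  finally show ?thesis
    using refl_op_carrier[OF norm] by (simp add: GLE.m_assoc heis_carrier heis_mult form_simps)
qed

text \<open>
  The factorization applies with the families \<open>k\<close> whose central operator lies in \<open>F\<close>.
\<close>

theorem rank_one_weyl_normal_form:
  assumes l: "l = 1" and w: "w \<in> affine_weyl"
  shows "\<exists>!(n, m, z). n \<in> {0, 1} \<and> m \<in> {1..nu} \<rightarrow>\<^sub>E (UNIV :: int set) \<and> z \<in> F \<and>
            w = refl_op form Vd (\<alpha> 1) [^]\<^bsub>\<G>\<^esub> (n :: nat)
                \<otimes>\<^bsub>\<G>\<^esub> ordered_prod \<G> (\<lambda>r. T_op form Vd (\<alpha> 1) (\<sigma> r) [^]\<^bsub>\<G>\<^esub> m r) [1..<nu + 1]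
                \<otimes>\<^bsub>\<G>\<^esub> z"
    (is "\<exists>!(n, m, z). ?P n m z")
proof -
  let ?s = "refl_op form Vd (\<alpha> 1)"
  let ?p = "\<lambda>(m :: nat \<Rightarrow> int) r. of_int (m r) *\<^sub>R \<alpha> 1"
  interpret F: subgroup F \<G>
    by (rule subgroup_F)
  have \<alpha>1: "\<alpha> 1 \<in> \<Phi>"
    using simple_root l by simp
  have norm: "form (\<alpha> 1) (\<alpha> 1) = 2" and \<alpha>1_Vd: "\<alpha> 1 \<in> Vd"
    using root_norm root_Vd \<alpha>1 by simp_all
  then have nz: "\<alpha> 1 \<noteq> 0"
    by (auto simp: form_simps)
  note s = refl_op_carrier[OF norm]
  have s_weyl: "?s [^]\<^bsub>\<G>\<^esub> (n::nat) \<in> finite_weyl" for n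
    by (induction n) (auto intro: generate.intros \<alpha>1)
  have s_one: "?s \<noteq> \<one>\<^bsub>\<G>\<^esub>"
  proof
    assume "?s = \<one>\<^bsub>\<G>\<^esub>"
    moreover have E: "(\<alpha> 1, 0) \<in> E"
      by (simp add: E_iff)
    ultimately have "?s (\<alpha> 1, 0) = (\<alpha> 1, 0)"
      by (simp add: GL_one)
    then show False
      using nz by (simp add: refl_op_apply[OF norm E] norm)
  qed
  have unique: "n = n' \<and> m = m' \<and> z = z'" if "?P n m z" "?P n' m' z'" for n n' m m' z z'
  proof -
    from that F_central obtain k k' where z: "z = central k" "z' = central k'"
      by (meson rangeE subsetD)
    have eq: "?s [^]\<^bsub>\<G>\<^esub> n \<otimes>\<^bsub>\<G>\<^esub> heis (?p m) k = ?s [^]\<^bsub>\<G>\<^esub> n' \<otimes>\<^bsub>\<G>\<^esub> heis (?p m') k'"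
      using that unfolding z rank_one_normal_form_eq_heis[OF l] by metis
    have ext: "m \<in> {1..nu} \<rightarrow>\<^sub>E UNIV" "m' \<in> {1..nu} \<rightarrow>\<^sub>E UNIV" and nn: "n \<in> {0, 1}" "n' \<in> {0, 1}"
      using that by blast+
    have u: "?s [^]\<^bsub>\<G>\<^esub> n = ?s [^]\<^bsub>\<G>\<^esub> n'" "heis (?p m) k = heis (?p m') k'"
      by (rule weyl_heis_unique[OF _ s_weyl s_weyl eq]; rule root_normed; assumption)+
    have pV: "of_int a *\<^sub>R \<alpha> 1 \<in> Vd" for a :: int
      using \<alpha>1_Vd subspace_Vd by (simp add: subspace_scale)
    note h = heis_eqD[of "?p m" "?p m'", OF pV pV u(2)]
    have "n = n'"
      using nn u(1) GLE.pow_one[OF s] s_one by auto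
    moreover have "m r = m' r" if "r \<in> {1..nu}" for r
      using h(1)[OF that] nz by simp
    then have "m = m'"
      using ext by (intro PiE_ext[of m "{1..nu}"]) auto
    moreover have "z = z'"
      unfolding z by (rule heis_cong) (use h(2) in auto)
    ultimately show ?thesis
      by blast
  qed
  let ?K = "{k. central k \<in> F}"
  obtain wd p k where wd: "wd \<in> finite_weyl" and p: "\<And>r. p r \<in> root_lattice"
    and k: "k \<in> ?K" and w_eq: "w = wd \<otimes>\<^bsub>\<G>\<^esub> heis p k"
  proof (rule affine_weyl_factorization[OF _ _ _ _ w, of ?K])
    show "(\<lambda>_ _. 0) \<in> ?K"
      using F.one_closed by (simp add: heis_zero)
    show "(\<lambda>r s. k r s + k' r s) \<in> ?K" if "k \<in> ?K" "k' \<in> ?K" for k k'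
      using F.m_closed[of "central k" "central k'"] that by (simp add: central_mult)
    show "(\<lambda>r s. - (of_int (a r) * of_int (a s))) \<in> ?K" if "a \<in> lattice_coords" for a
      using quadratic_central_in_F[OF that] by simp
    show "(\<lambda>r s. of_int (a r) * form (p s) \<beta>) \<in> ?K"
      if "\<And>r. p r \<in> root_lattice" "\<beta> \<in> \<Phi>" for p \<beta> and a :: "nat \<Rightarrow> int"
      using rank_one_central_in_F[OF l that] by simp
  qed auto
  obtain n :: nat where n: "n \<in> {0, 1}" "wd = ?s [^]\<^bsub>\<G>\<^esub> n"
    using rank_one_weyl[OF l wd] by blast
  have "\<exists>m :: int. p r = of_int m *\<^sub>R \<alpha> 1" for r
    using rank_one_lattice[OF l p] .
  then obtain m :: "nat \<Rightarrow> int" where m: "\<And>r. p r = of_int (m r) *\<^sub>R \<alpha> 1"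
    by metis
  have "heis p k = heis (?p (restrict m {1..nu})) k"
    by (rule heis_cong) (simp_all add: m)
  then have "w = ?s [^]\<^bsub>\<G>\<^esub> n \<otimes>\<^bsub>\<G>\<^esub> heis (?p (restrict m {1..nu})) k"
    using w_eq n(2) by simp
  then have "?P n (restrict m {1..nu}) (central k)"
    unfolding rank_one_normal_form_eq_heis[OF l] using n(1) k by simp
  then show ?thesis
    using unique by (rule ex1_tripleI[of ?P n "restrict m {1..nu}" "central k"])
qed

end

section \<open>Root lengths and the dual basis\<close>

lemma independent_family_eqD:
  fixes f :: "'i \<Rightarrow> 'v::real_vector"
  assumes "finite I" "inj_on f I" "independent (f ` I)"
    and eq: "(\<Sum>i\<in>I. a i *\<^sub>R f i) = (\<Sum>i\<in>I. b i *\<^sub>R f i)" and i: "i \<in> I"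
  shows "a i = b i"
proof -
  define u where "u v = a (inv_into I f v) - b (inv_into I f v)" for v
  have "(\<Sum>v\<in>f ` I. u v *\<^sub>R v) = (\<Sum>i\<in>I. (a i - b i) *\<^sub>R f i)"
    using assms(2) by (simp add: sum.reindex u_def)
  also have "\<dots> = 0"
    using eq by (simp add: scaleR_left_diff_distrib sum_subtractf)
  finally have "u (f i) = 0"
    using independentD[OF assms(3) _ subset_refl, of u "f i"] assms(1) i by blast
  then show ?thesis
    using assms(2) i by (simp add: u_def)
qed

text \<open>
  Every root is conjugate to a simple root under simple reflections, hence as long as a simple root.  The
  proof is by induction on the height of a positive root \<open>\<gamma>\<close>: since \<open>(\<gamma>, \<gamma>) > 0\<close>, some simple root
  \<open>\<alpha>\<^sub>i\<close> in it has \<open>(\<gamma>, \<alpha>\<^sub>i) > 0\<close>, and reflecting in \<open>\<alpha>\<^sub>i\<close> lowers the height, unless the result is a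
  negative root, which forces \<open>\<gamma> = \<alpha>\<^sub>i\<close>.
\<close>

lemma simply_laced_root_norm:
  assumes form: "bilinear form" "\<And>x y. form x y = form y x"
    and \<Phi>: "finite_root_system form U \<Phi>" and \<alpha>: "fundamental_system \<Phi> l \<alpha>"
    and norm: "\<And>i. i \<in> {1..l} \<Longrightarrow> form (\<alpha> i) (\<alpha> i) = 2"
    and \<beta>: "\<beta> \<in> \<Phi> - {0}"
  shows "form \<beta> \<beta> = 2"
proof -
  note form_simps = bilinear_lmul[OF form(1)] bilinear_rmul[OF form(1)]
    bilinear_lsub[OF form(1)] bilinear_rsub[OF form(1)]
    bilinear_lneg[OF form(1)] bilinear_rneg[OF form(1)]
    bilinear_lzero[OF form(1)] bilinear_rzero[OF form(1)]
  have root: "0 < form \<gamma> \<gamma>" "2 *\<^sub>R \<gamma> \<notin> \<Phi>" if "\<gamma> \<in> \<Phi>" "\<gamma> \<noteq> 0" for \<gamma>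
    using \<Phi> that by (auto simp: finite_root_system_def)
  have reflect: "form \<delta> (coroot form \<gamma>) \<in> \<int>" "\<delta> - form \<delta> (coroot form \<gamma>) *\<^sub>R \<gamma> \<in> \<Phi>"
    if "\<gamma> \<in> \<Phi>" "\<gamma> \<noteq> 0" "\<delta> \<in> \<Phi>" for \<gamma> \<delta>
    using \<Phi> that by (auto simp: finite_root_system_def)
  have simple: "\<alpha> i \<in> \<Phi>" "\<alpha> i \<noteq> 0" if "i \<in> {1..l}" for i
    using \<alpha> norm[OF that] that by (auto simp: fundamental_system_def form_simps)
  have indep: "a i = b i" if "(\<Sum>j = 1..l. a j *\<^sub>R \<alpha> j) = (\<Sum>j = 1..l. b j *\<^sub>R \<alpha> j)" "i \<in> {1..l}"
    for a b i
    using independent_family_eqD[OF _ _ _ that(1) that(2)] \<alpha> by (simp add: fundamental_system_def)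
  have signed: "\<exists>n :: nat \<Rightarrow> nat. \<gamma> = (\<Sum>i = 1..l. real (n i) *\<^sub>R \<alpha> i) \<or> \<gamma> = - (\<Sum>i = 1..l. real (n i) *\<^sub>R \<alpha> i)"
    if "\<gamma> \<in> \<Phi>" for \<gamma>
    using \<alpha> that by (simp add: fundamental_system_def)
  have positive: "form \<gamma> \<gamma> = 2"
    if "\<gamma> \<in> \<Phi>" "\<gamma> \<noteq> 0" "\<gamma> = (\<Sum>i = 1..l. real (n i) *\<^sub>R \<alpha> i)" for \<gamma> and n :: "nat \<Rightarrow> nat"
    using that
  proof (induction "\<Sum>i = 1..l. n i" arbitrary: n \<gamma> rule: less_induct)
    case less
    have "form \<gamma> \<gamma> = (\<Sum>i = 1..l. real (n i) * form \<gamma> (\<alpha> i))"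
    proof -
      have "form \<gamma> (\<Sum>i = 1..l. real (n i) *\<^sub>R \<alpha> i) = (\<Sum>i = 1..l. real (n i) * form \<gamma> (\<alpha> i))"
        using form(1) by (simp add: bilinear_def linear_sum form_simps)
      then show ?thesis
        using less.prems(3) by simp
    qed
    with root(1)[OF less.prems(1,2)] have "\<not> (\<Sum>i = 1..l. real (n i) * form \<gamma> (\<alpha> i)) \<le> 0"
      by simp
    then obtain i where i: "i \<in> {1..l}" and pos: "0 < real (n i) * form \<gamma> (\<alpha> i)"
      using sum_nonpos[of "{1..l}" "\<lambda>i. real (n i) * form \<gamma> (\<alpha> i)"] by (meson not_le)
    have co: "form \<gamma> (coroot form (\<alpha> i)) = form \<gamma> (\<alpha> i)"
      using norm[OF i] by (simp add: coroot_def)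
    obtain c :: int where c: "form \<gamma> (\<alpha> i) = of_int c"
      using reflect(1)[OF simple[OF i] less.prems(1)] unfolding co by (auto elim: Ints_cases)
    have "0 < c" "0 < n i"
      using pos c by (simp_all add: zero_less_mult_iff)
    define \<delta> where "\<delta> = \<gamma> - of_int c *\<^sub>R \<alpha> i"
    have \<delta>: "\<delta> \<in> \<Phi>"
      using reflect(2)[OF simple[OF i] less.prems(1)] unfolding co c \<delta>_def .
    have norm_eq: "form \<delta> \<delta> = form \<gamma> \<gamma>"
      using norm[OF i] c form(2)[of "\<alpha> i" \<gamma>] by (simp add: \<delta>_def form_simps)
    then have "\<delta> \<noteq> 0"
      using root(1)[OF less.prems(1,2)] by (auto simp: form_simps)
    have "\<gamma> - of_int c *\<^sub>R \<alpha> i = (\<Sum>j = 1..l. (real (n j) - (if j = i then of_int c else 0)) *\<^sub>R \<alpha> j)"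
      using i by (subst less.prems(3)) (simp add: scaleR_left_diff_distrib sum_subtractf
          if_distrib[of "\<lambda>x. x *\<^sub>R _"] sum.delta cong: if_cong)
    then have \<delta>_sum: "\<delta> = (\<Sum>j = 1..l. (real (n j) - (if j = i then of_int c else 0)) *\<^sub>R \<alpha> j)"
      by (simp add: \<delta>_def)
    obtain m :: "nat \<Rightarrow> nat" where "\<delta> = (\<Sum>j = 1..l. real (m j) *\<^sub>R \<alpha> j) \<or> \<delta> = - (\<Sum>j = 1..l. real (m j) *\<^sub>R \<alpha> j)"
      using signed[OF \<delta>] by blast
    then consider (pos) "\<delta> = (\<Sum>j = 1..l. real (m j) *\<^sub>R \<alpha> j)" | (neg) "\<delta> = (\<Sum>j = 1..l. (- real (m j)) *\<^sub>R \<alpha> j)"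
      by (auto simp: sum_negf)
    then show ?case
    proof cases
      case pos
      have m: "real (m j) = real (n j) - (if j = i then of_int c else 0)" if "j \<in> {1..l}" for j
        using indep[OF trans[OF pos[symmetric] \<delta>_sum] that] .
      have "m j \<le> n j" if "j \<in> {1..l}" for j
        using m[OF that] \<open>0 < c\<close> by (simp split: if_splits)
      moreover have "m i < n i"
        using m[OF i] \<open>0 < c\<close> by simp
      ultimately have "(\<Sum>j = 1..l. m j) < (\<Sum>j = 1..l. n j)"
        using i by (intro sum_strict_mono_ex1) auto
      from less.hyps[OF this \<delta> \<open>\<delta> \<noteq> 0\<close> pos] show ?thesis
        by (simp add: norm_eq)
    next
      case neg
      have m: "- real (m j) = real (n j) - (if j = i then of_int c else 0)" if "j \<in> {1..l}" for j
        using indep[OF trans[OF neg[symmetric] \<delta>_sum] that] .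
      \<comment> \<open>Only the coefficient at \<open>\<alpha>\<^sub>i\<close> changes, so a negative \<open>\<delta>\<close> leaves no other coefficient in \<open>\<gamma>\<close>.\<close>
      have n0: "real (n j) *\<^sub>R \<alpha> j = (if j = i then real (n i) *\<^sub>R \<alpha> i else 0)" if "j \<in> {1..l}" for j
        using m[OF that] by auto
      have "\<gamma> = (\<Sum>j = 1..l. if j = i then real (n i) *\<^sub>R \<alpha> i else 0)"
        unfolding less.prems(3) using n0 by (rule sum.cong[OF refl])
      then have \<gamma>: "\<gamma> = real (n i) *\<^sub>R \<alpha> i"
        using i by simp
      \<comment> \<open>The pairing is an integer, which leaves \<open>\<gamma> = \<alpha>\<^sub>i\<close> and \<open>\<gamma> = 2 \<alpha>\<^sub>i\<close>; the latter is not a root.\<close>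
      have "form (\<alpha> i) (coroot form \<gamma>) = 2 / real (n i)"
        using norm[OF i] \<open>0 < n i\<close> by (simp add: \<gamma> coroot_def form_simps)
      then obtain d :: int where "2 / real (n i) = of_int d"
        using reflect(1)[OF less.prems(1,2) simple(1)[OF i]] by (auto elim: Ints_cases)
      then have "2 = real_of_int (d * int (n i))"
        using \<open>0 < n i\<close> by (simp add: field_simps)
      then have "d * int (n i) = 2"
        by linarith
      then have "int (n i) dvd 2"
        by (metis dvd_triv_right)
      then have "n i \<le> 2"
        using zdvd_imp_le by fastforce
      moreover have "n i \<noteq> 2"
        using root(2)[OF simple[OF i]] less.prems(1) \<gamma> by auto
      ultimately have "n i = 1"
        using \<open>0 < n i\<close> by linarith
      then show ?thesis
        using \<gamma> norm[OF i] by simp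
    qed
  qed
  have neg: "- \<beta> \<in> \<Phi>"
  proof -
    have "form \<beta> \<beta> \<noteq> 0"
      using root(1)[of \<beta>] \<beta> by auto
    then have "\<beta> - form \<beta> (coroot form \<beta>) *\<^sub>R \<beta> = - \<beta>"
      by (simp add: coroot_def form_simps scaleR_2)
    then show ?thesis
      using reflect(2)[of \<beta> \<beta>] \<beta> by simp
  qed
  obtain n :: "nat \<Rightarrow> nat" where n: "\<beta> = (\<Sum>i = 1..l. real (n i) *\<^sub>R \<alpha> i) \<or> - \<beta> = (\<Sum>i = 1..l. real (n i) *\<^sub>R \<alpha> i)"
    using signed[of \<beta>] \<beta> by (metis DiffD1 minus_minus)
  have "form (- \<beta>) (- \<beta>) = form \<beta> \<beta>"
    by (simp add: form_simps)
  moreover have "- \<beta> \<noteq> 0"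
    using \<beta> by simp
  then have "form \<beta> \<beta> = 2 \<or> form (- \<beta>) (- \<beta>) = 2"
    using n positive[of \<beta> n] positive[of "- \<beta>" n] \<beta> neg by blast
  ultimately show ?thesis
    by simp
qed

text \<open>
  By counting dimensions, the vectors \<open>\<sigma>\<^sub>r\<close> together with a basis of \<open>Vd\<close> form a basis of the whole
  space, on which the functional can be prescribed.
\<close>

lemma dual_functional_exists:
  fixes \<sigma> :: "nat \<Rightarrow> 'v::euclidean_space"
  assumes V0: "subspace V0" and Vd: "subspace Vd" and "V0 \<inter> Vd = {0}" and sum: "V0 + Vd = UNIV"
    and inj: "inj_on \<sigma> {1..nu}" and span: "span (\<sigma> ` {1..nu}) = V0" and dim: "dim V0 = nu" and s: "s \<in> {1..nu}"
  shows "\<exists>f :: 'v \<Rightarrow>\<^sub>L real. (\<forall>x \<in> Vd. blinfun_apply f x = 0) \<and>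
          (\<forall>r \<in> {1..nu}. blinfun_apply f (\<sigma> r) = (if r = s then 1 else 0))"
proof -
  obtain C where C: "C \<subseteq> Vd" "independent C" "Vd \<subseteq> span C" "card C = dim Vd"
    using basis_exists[of Vd] by blast
  have "finite C"
    using C(2) by (rule independent_imp_finite)
  have "{x + y | x y. x \<in> V0 \<and> y \<in> Vd} = V0 + Vd"
    by (auto simp: set_plus_def)
  then have dims: "DIM('v) = nu + dim Vd"
    using dim_sums_Int[OF V0 Vd] assms(3) sum dim by simp
  have "independent (\<sigma> ` {1..nu} \<union> C)"
  proof (rule card_le_dim_spanning[where V = UNIV])
    show "UNIV \<subseteq> span (\<sigma> ` {1..nu} \<union> C)"
    proof
      fix v :: 'v
      have "v \<in> V0 + Vd"
        using sum by simp
      then obtain x y where v: "v = x + y" "x \<in> V0" "y \<in> Vd"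
        by (auto elim: set_plus_elim)
      have "x \<in> span (\<sigma> ` {1..nu} \<union> C)"
        using v(2) span span_mono[of "\<sigma> ` {1..nu}" "\<sigma> ` {1..nu} \<union> C"] by blast
      moreover have "y \<in> span (\<sigma> ` {1..nu} \<union> C)"
        using v(3) C(3) span_mono[of C "\<sigma> ` {1..nu} \<union> C"] by blast
      ultimately show "v \<in> span (\<sigma> ` {1..nu} \<union> C)"
        unfolding v(1) by (rule span_add)
    qed
    have "card (\<sigma> ` {1..nu} \<union> C) \<le> card (\<sigma> ` {1..nu}) + card C"
      by (rule card_Un_le)
    also have "\<dots> \<le> nu + card C"
      using card_image_le[of "{1..nu}" \<sigma>] by simp
    finally show "card (\<sigma> ` {1..nu} \<union> C) \<le> dim (UNIV :: 'v set)"
      using dims C(4) by simp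
  qed (use \<open>finite C\<close> in auto)
  from linear_independent_extend[OF this, of "\<lambda>x. if x = \<sigma> s then 1 else 0 :: real"]
  obtain g :: "'v \<Rightarrow> real" where g: "linear g"
      "\<forall>x \<in> \<sigma> ` {1..nu} \<union> C. g x = (if x = \<sigma> s then 1 else 0)"
    by blast
  have "\<sigma> s \<notin> C"
  proof
    assume "\<sigma> s \<in> C"
    moreover have "\<sigma> s \<in> V0"
      using s span span_base[of "\<sigma> s" "\<sigma> ` {1..nu}"] by blast
    ultimately have "0 \<in> C"
      using C(1) assms(3) by (metis IntI singletonD subsetD)
    then show False
      using C(2) dependent_zero by blast
  qed
  have bl: "blinfun_apply (Blinfun g) = g"
    using g(1) by (simp add: bounded_linear_Blinfun_apply linear_conv_bounded_linear)
  show ?thesis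
  proof (intro exI conjI ballI)
    show "blinfun_apply (Blinfun g) x = 0" if "x \<in> Vd" for x
    proof -
      have "g y = 0" if "y \<in> C" for y
        using g(2) that \<open>\<sigma> s \<notin> C\<close> by auto
      then show ?thesis
        unfolding bl using linear_eq_0_on_span[OF g(1)] that C(3) by blast
    qed
    show "blinfun_apply (Blinfun g) (\<sigma> r) = (if r = s then 1 else 0)" if "r \<in> {1..nu}" for r
    proof -
      have "\<sigma> r = \<sigma> s \<longleftrightarrow> r = s"
        using inj that s by (rule inj_on_eq_iff)
      moreover have "\<sigma> r \<in> \<sigma> ` {1..nu} \<union> C"
        using that by blast
      ultimately show ?thesis
        unfolding bl using g(2) by simp
    qed
  qed
qed

section \<open>The extended affine Weyl group\<close>

theorem proposition2p26:
  fixes form :: "'v::euclidean_space \<Rightarrow> 'v \<Rightarrow> real"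
    and R Vd Rd S :: "'v set"
    and X :: simply_laced_type
    and l nu :: nat
    and \<alpha> \<sigma> :: "nat \<Rightarrow> 'v"
    and G (structure)
  assumes ears: "extended_affine_root_system form R"
    and rank: "l = form_rank form"
    and nullity: "nu = nullity form"
    and complement: "subspace Vd" "form_radical form \<inter> Vd = {0}" "form_radical form + Vd = UNIV"
    and Rd: "Rd = finite_part form Vd R"
    and type: "finite_root_system_of_type form Vd Rd X" "type_rank X = l"
    and S: "semilattice_in (form_radical form) S" "l > 1 \<longrightarrow> lattice_in (form_radical form) S"
    and R_eq: "R = (S + S) \<union> (Rd + S)"
    and \<alpha>: "fundamental_system Rd l \<alpha>" "\<forall>i \<in> {1..l}. form (\<alpha> i) (\<alpha> i) = 2"
    and \<sigma>: "int_basis_of \<sigma> nu (zmod.span S)" "\<sigma> ` {1..nu} \<subseteq> S"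
    and G: "G = GL (ext_space Vd)"
  shows
    "(X = TypeA 1 \<longrightarrow>
       (\<forall>w \<in> weyl_group form Vd R.
          \<exists>!(n, m, z). n \<in> {0, 1} \<and> m \<in> {1..nu} \<rightarrow>\<^sub>E (UNIV :: int set) \<and> z \<in> F_group form Vd S \<sigma> nu \<and>
            w = refl_op form Vd (\<alpha> 1) [^] (n :: nat)
                \<otimes> ordered_prod G (\<lambda>r. T_op form Vd (\<alpha> 1) (\<sigma> r) [^] m r) [1..<nu + 1]
                \<otimes> z)) \<and>
     ((X = TypeA l \<and> l \<ge> 2) \<or> X = TypeD l \<or> X = TypeE l \<longrightarrow>
       (\<forall>w \<in> weyl_group form Vd R.
          \<exists>!(wd, m, k). wd \<in> weyl_group form Vd Rd \<and>
            m \<in> {1..l} \<times> {1..nu} \<rightarrow>\<^sub>E (UNIV :: int set) \<and>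
            k \<in> {(r, s). 1 \<le> r \<and> r < s \<and> s \<le> nu} \<rightarrow>\<^sub>E (UNIV :: int set) \<and>
            w = wd
                \<otimes> ordered_prod G (\<lambda>r. ordered_prod G
                     (\<lambda>i. T_op form Vd (\<alpha> i) (\<sigma> r) [^] m (i, r)) [1..<l + 1]) [1..<nu + 1]
                \<otimes> ordered_prod G (\<lambda>(r, s). c_op form Vd \<sigma> r s [^] k (r, s)) (index_pairs nu)))"
proof -
  have psd: "psd_form form"
    using ears by (simp add: extended_affine_root_system_def)
  then have bil: "bilinear form" and sym: "form x y = form y x" for x y
    by (simp_all add: psd_form_def)
  let ?V0 = "form_radical form"
  let ?\<Phi> = "nonisotropic form Rd"
  have V0: "subspace ?V0"
    by (simp add: subspace_def form_radical_def bilinear_ladd[OF bil] bilinear_lmul[OF bil] bilinear_lzero[OF bil])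
  have radical: "form x y = 0" "form y x = 0" if "x \<in> ?V0" for x y
    using that sym[of y x] by (simp_all add: form_radical_def)
  have S_V0: "S \<subseteq> ?V0"
    using S(1) span_superset by (auto simp: semilattice_in_def)
  have frs: "finite_root_system form Vd Rd"
    using type(1) by (simp add: finite_root_system_of_type_def)
  have Rd_Vd: "Rd \<subseteq> Vd"
    by (auto simp: Rd finite_part_def)
  have \<Phi>: "?\<Phi> = Rd - {0}"
    using frs by (force simp: nonisotropic_def finite_root_system_def bilinear_lzero[OF bil])
  have norm: "form \<beta> \<beta> = 2" if "\<beta> \<in> ?\<Phi>" for \<beta>
    using simply_laced_root_norm[OF bil sym frs \<alpha>(1)] \<alpha>(2) that unfolding \<Phi> by blast
  have inj: "inj_on \<sigma> {1..nu}" and indep: "zmod.independent (\<sigma> ` {1..nu})"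
    and zspan: "zmod.span (\<sigma> ` {1..nu}) = zmod.span S"
    using \<sigma>(1) by (simp_all add: int_basis_of_def)
  have coords: "(\<Sum>r = 1..nu. of_int (zmod.representation (\<sigma> ` {1..nu}) \<tau> (\<sigma> r)) *\<^sub>R \<sigma> r) = \<tau>" if "\<tau> \<in> S" for \<tau>
  proof -
    have "\<tau> \<in> zmod.span (\<sigma> ` {1..nu})"
      unfolding zspan using that by (rule zmod.span_base)
    from zmod.sum_representation_eq[OF indep this, of "\<sigma> ` {1..nu}"] show ?thesis
      using inj by (simp add: sum.reindex)
  qed
  \<comment> \<open>The integral coordinates show that the \<open>\<sigma>\<^sub>r\<close> span \<open>V\<^sup>0\<close> over the reals; being \<open>dim V\<^sup>0\<close> many, they form a basis.\<close>
  have span: "span (\<sigma> ` {1..nu}) = ?V0"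
  proof
    show "span (\<sigma> ` {1..nu}) \<subseteq> ?V0"
      using \<sigma>(2) S_V0 V0 by (intro span_minimal) auto
    have "S \<subseteq> span (\<sigma> ` {1..nu})"
    proof
      fix \<tau> assume "\<tau> \<in> S"
      show "\<tau> \<in> span (\<sigma> ` {1..nu})"
        by (subst coords[OF \<open>\<tau> \<in> S\<close>, symmetric]) (intro span_sum span_scale span_base imageI)
    qed
    then have "span S \<subseteq> span (\<sigma> ` {1..nu})"
      by (intro span_minimal) simp_all
    then show "?V0 \<subseteq> span (\<sigma> ` {1..nu})"
      using S(1) by (simp add: semilattice_in_def)
  qed
  interpret simply_laced_extension form Vd \<sigma> nu ?\<Phi> S \<alpha> l
  proof
    show "bilinear form" "subspace Vd"
      by (fact bil complement)+
    show "form x y = form y x" for x y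
      by (rule sym)
    show "form (\<sigma> r) x = 0" if "r \<in> {1..nu}" for r x
      using that \<sigma>(2) S_V0 radical by blast
    show "\<exists>f :: 'v \<Rightarrow>\<^sub>L real. (\<forall>x \<in> Vd. blinfun_apply f x = 0) \<and>
          (\<forall>r \<in> {1..nu}. blinfun_apply f (\<sigma> r) = (if r = s then 1 else 0))" if "s \<in> {1..nu}" for s
      using dual_functional_exists[OF V0 complement inj span _ that] nullity by (simp add: nullity_def)
    show "\<exists>x \<in> Vd. \<exists>c. v = x + (\<Sum>r = 1..nu. c r *\<^sub>R \<sigma> r)" for v
    proof -
      have "v \<in> ?V0 + Vd"
        using complement(3) by simp
      then obtain x y where v: "v = x + y" "x \<in> ?V0" "y \<in> Vd"
        by (auto elim: set_plus_elim)
      then have "x \<in> range (\<lambda>u. \<Sum>v\<in>\<sigma> ` {1..nu}. u v *\<^sub>R v)"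
        using span_finite[of "\<sigma> ` {1..nu}"] span by simp
      then obtain u where "x = (\<Sum>v\<in>\<sigma> ` {1..nu}. u v *\<^sub>R v)"
        by blast
      then have "x = (\<Sum>r = 1..nu. u (\<sigma> r) *\<^sub>R \<sigma> r)"
        using inj by (simp add: sum.reindex)
      then show ?thesis
        using v by (intro bexI[of _ y] exI[of _ "\<lambda>r. u (\<sigma> r)"]) (simp_all add: add.commute)
    qed
    show "form \<beta> \<beta> = 2" if "\<beta> \<in> ?\<Phi>" for \<beta>
      using that by (rule norm)
    show "\<beta> \<in> Vd" if "\<beta> \<in> ?\<Phi>" for \<beta>
      using that \<Phi> Rd_Vd by blast
    show "\<exists>n :: nat \<Rightarrow> int. \<beta> = (\<Sum>i = 1..l. of_int (n i) *\<^sub>R \<alpha> i)" if "\<beta> \<in> ?\<Phi>" for \<beta>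
    proof -
      obtain n :: "nat \<Rightarrow> nat" where n: "\<beta> = (\<Sum>i = 1..l. real (n i) *\<^sub>R \<alpha> i) \<or> \<beta> = - (\<Sum>i = 1..l. real (n i) *\<^sub>R \<alpha> i)"
        using \<alpha>(1) \<open>\<beta> \<in> ?\<Phi>\<close> unfolding \<Phi> fundamental_system_def by blast
      then show ?thesis
        by (elim disjE; intro exI[of _ "\<lambda>i. int (n i)"] exI[of _ "\<lambda>i. - int (n i)"]) (simp_all add: sum_negf)
    qed
    show "form \<beta> \<gamma> \<in> \<int>" if "\<beta> \<in> ?\<Phi>" "\<gamma> \<in> ?\<Phi>" for \<beta> \<gamma>
    proof -
      have "form \<beta> (coroot form \<gamma>) \<in> \<int>"
        using frs that unfolding \<Phi> finite_root_system_def by blast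
      then show ?thesis
        using norm[OF that(2)] by (simp add: coroot_def)
    qed
    show "\<alpha> i \<in> ?\<Phi>" if "i \<in> {1..l}" for i
      using \<alpha> that by (auto simp: nonisotropic_def fundamental_system_def)
    show "a i = b i" if "(\<Sum>i = 1..l. a i *\<^sub>R \<alpha> i) = (\<Sum>i = 1..l. b i *\<^sub>R \<alpha> i)" "i \<in> {1..l}" for a b i
      using independent_family_eqD[OF _ _ _ that] \<alpha>(1) by (simp add: fundamental_system_def)
  qed (rule coords)
  have "nonisotropic form R = {\<beta> + \<tau> | \<beta> \<tau>. \<beta> \<in> ?\<Phi> \<and> \<tau> \<in> S}"
  proof -
    have tt: "form (\<beta> + \<tau>) (\<beta> + \<tau>) = form \<beta> \<beta>" if "\<tau> \<in> S" for \<beta> \<tau>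
      using that S_V0 radical by (simp add: bilinear_ladd[OF bil] bilinear_radd[OF bil] subset_iff)
    have "form \<tau> \<tau> = 0" if "\<tau> \<in> S" for \<tau>
      using that S_V0 radical by blast
    with tt show ?thesis
      unfolding R_eq by (auto simp: nonisotropic_def set_plus_def) blast+
  qed
  then have affine: "weyl_group form Vd R = affine_weyl" and finite: "weyl_group form Vd Rd = finite_weyl"
    by (simp_all add: weyl_group_def)
  show ?thesis
    unfolding G affine finite
  proof (intro conjI impI ballI)
    assume "X = TypeA 1"
    then have "l = 1"
      using type(2) by simp
    then show "\<exists>!(n, m, z). n \<in> {0, 1} \<and> m \<in> {1..nu} \<rightarrow>\<^sub>E (UNIV :: int set) \<and> z \<in> F \<and>
            w = refl_op form Vd (\<alpha> 1) [^]\<^bsub>\<G>\<^esub> (n :: nat)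
                \<otimes>\<^bsub>\<G>\<^esub> ordered_prod \<G> (\<lambda>r. T_op form Vd (\<alpha> 1) (\<sigma> r) [^]\<^bsub>\<G>\<^esub> m r) [1..<nu + 1]
                \<otimes>\<^bsub>\<G>\<^esub> z" if "w \<in> affine_weyl" for w
      using that by (rule rank_one_weyl_normal_form)
  qed (rule weyl_normal_form)
qed

end
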